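(* There exists an absolute constant $c>0$ such that for any $\epsilon>0$, $0<\delta<0.1$, positive integers $m<n/2$, any $\sigma_1^2,\dots,\sigma_n^2>0$, and any algorithm that solves the $(\epsilon,\delta)$ top-$m$ arm identification problem, there exists an instance with the given variance proxies on which the expected number of samples of the algorithm is at least \[ c\left(\sum_{i\in[n]}\frac{\sigma_i^2}{\epsilon^2}\ln\frac1\delta+\sum_{i\in G^{m}}\frac{\sigma_i^2}{\epsilon^2}\ln(m)+\sum_{j\in G^{l}}\frac{\sigma_j^2}{\epsilon^2}\mathrm{Ent}(\sigma^2_{G^{r}})\right). \]
   Context: Bandit setting: $n$ arms; pulling arm $i$ returns an independent sample from a distribution $\nu_i$ with unknown mean $\mu_i$ that is $\sigma_i^2$-sub-Gaussian ($\ln\mathbb E[e^{\lambda(X-\mu_i)}]\le\sigma_i^2\lambda^2/2$ for all real $\lambda$), $\sigma_i^2$ known; an instance with the given variance proxies is any such tuple $(\nu_1,\dots,\nu_n)$. An algorithm adaptively pulls arms, stops, and returns $m$ arms; $\max^m_{i\in S}\mu_i$ is the $m$-th largest mean in $S$; an arm is $\epsilon$-approximate top-$m$ if its mean is $\ge\max^m_{i\in[n]}\mu_i-\epsilon$; the algorithm solves the $(\epsilon,\delta)$ top-$m$ arm identification problem if on every instance, with probability $\ge1-\delta$, all returned arms are $\epsilon$-approximate top-$m$. Entropy: $\mathrm{Ent}(a)=-\sum_i\hat a_i\ln\hat a_i$, $\hat a_i=a_i/\sum_ja_j$; $\sigma^2_S=(\sigma_i^2)_{i\in S}$. Grouping: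 $\underline\sigma^2=\min_i\sigma_i^2$, $G_j=\{i:2^{j-1}\le\sigma_i^2/\underline\sigma^2<2^j\}$, $j=1,\dots,k$ covering $[n]$. $G^{m}=\bigcup_{j:|G_j|>2m}G_j$, $G^{l}=\bigcup_{j:|G_j|\le2m}G_j$. $G'_j=G_j$ if $|G_j|\le2m$, otherwise $G'_j\subset G_j$ with $|G'_j|=2m$; $G^{r}=\bigcup_jG'_j$ with the choices made to maximize $\mathrm{Ent}(\sigma^2_{G^{r}})$. *)

theory Defs
  imports "HOL-Probability.Probability"
begin

text \<open>Arms are indexed by 0,...,n-1 (the paper's [n]). The variance proxies are
  a function s (s i = sigma_i^2). An instance is a tuple of reward distributions
  (probability measures on the Borel reals) nu i, i < n.\<close>

definition arm_mean :: "(nat \<Rightarrow> real measure) \<Rightarrow> nat \<Rightarrow> real" where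
  "arm_mean \<nu> i = (\<integral>x. x \<partial>(\<nu> i))"

definition bandit_instance :: "nat \<Rightarrow> (nat \<Rightarrow> real) \<Rightarrow> (nat \<Rightarrow> real measure) \<Rightarrow> bool" where
  "bandit_instance n s \<nu> \<longleftrightarrow>
     (\<forall>i<n. prob_space (\<nu> i) \<and> sets (\<nu> i) = sets borel \<and>
        integrable (\<nu> i) (\<lambda>x. x) \<and>
        (\<forall>l::real. integrable (\<nu> i) (\<lambda>x. exp (l * (x - arm_mean \<nu> i))) \<and>
           ln (\<integral>x. exp (l * (x - arm_mean \<nu> i)) \<partial>(\<nu> i)) \<le> s i * l\<^sup>2 / 2))"

text \<open>An action is either pulling an arm or stopping and returning a set of arms.
  A (randomised) algorithm consists of a probability measure R on the Borel reals
  (its internal randomness, a seed) and a decision rule alg: given the seed and the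
  history of (arm, reward) pairs observed so far it decides the next action.
  The rewards are modelled by a table X i k = k-th sample of arm i; samples are
  i.i.d. from nu i and independent across arms and of the seed.\<close>

datatype action = Pull nat | Stop "nat set"

primrec hist :: "(real \<Rightarrow> (nat \<times> real) list \<Rightarrow> action) \<Rightarrow> real \<Rightarrow> (nat \<Rightarrow> nat \<Rightarrow> real) \<Rightarrow> nat
                  \<Rightarrow> (nat \<times> real) list" where
  "hist alg \<omega> X 0 = []"
| "hist alg \<omega> X (Suc t) =
     (case alg \<omega> (hist alg \<omega> X t) of
        Pull i \<Rightarrow> hist alg \<omega> X t @ [(i, X i (length (filter (\<lambda>p. fst p = i) (hist alg \<omega> X t))))]
      | Stop S \<Rightarrow> hist alg \<omega> X t)"

definition stopped :: "(real \<Rightarrow> (nat \<times> real) list \<Rightarrow> action) \<Rightarrow> real \<Rightarrow> (nat \<Rightarrow> nat \<Rightarrow> real) \<Rightarrow> nat \<Rightarrow> bool" where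
  "stopped alg \<omega> X t \<longleftrightarrow> (\<exists>S. alg \<omega> (hist alg \<omega> X t) = Stop S)"

definition num_samples :: "(real \<Rightarrow> (nat \<times> real) list \<Rightarrow> action) \<Rightarrow> real \<Rightarrow> (nat \<Rightarrow> nat \<Rightarrow> real) \<Rightarrow> ennreal" where
  "num_samples alg \<omega> X =
     (if \<exists>t. stopped alg \<omega> X t then of_nat (LEAST t. stopped alg \<omega> X t) else \<infinity>)"

definition alg_output :: "(real \<Rightarrow> (nat \<times> real) list \<Rightarrow> action) \<Rightarrow> real \<Rightarrow> (nat \<Rightarrow> nat \<Rightarrow> real) \<Rightarrow> nat set" where
  "alg_output alg \<omega> X =
     (case alg \<omega> (hist alg \<omega> X (LEAST t. stopped alg \<omega> X t)) of Stop S \<Rightarrow> S | Pull _ \<Rightarrow> {})"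

definition sample_space :: "nat \<Rightarrow> real measure \<Rightarrow> (nat \<Rightarrow> real measure) \<Rightarrow> (real \<times> (nat \<Rightarrow> nat \<Rightarrow> real)) measure" where
  "sample_space n R \<nu> = R \<Otimes>\<^sub>M (\<Pi>\<^sub>M i\<in>{..<n}. \<Pi>\<^sub>M k\<in>(UNIV::nat set). \<nu> i)"

text \<open>Measurability of the algorithm (implicit in the paper): each decision is a
  measurable function of the seed and the reward table.\<close>
definition alg_measurable :: "nat \<Rightarrow> (real \<Rightarrow> (nat \<times> real) list \<Rightarrow> action) \<Rightarrow> bool" where
  "alg_measurable n alg \<longleftrightarrow>
     (\<forall>t. (\<lambda>(\<omega>, X). alg \<omega> (hist alg \<omega> X t))
            \<in> borel \<Otimes>\<^sub>M (\<Pi>\<^sub>M i\<in>{..<n}. \<Pi>\<^sub>M k\<in>(UNIV::nat set). (borel :: real measure))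
              \<rightarrow>\<^sub>M count_space UNIV)"

definition expected_samples :: "nat \<Rightarrow> real measure \<Rightarrow> (nat \<Rightarrow> real measure) \<Rightarrow> (real \<Rightarrow> (nat \<times> real) list \<Rightarrow> action) \<Rightarrow> ennreal" where
  "expected_samples n R \<nu> alg = (\<integral>\<^sup>+ p. num_samples alg (fst p) (snd p) \<partial>(sample_space n R \<nu>))"

definition kth_largest :: "(nat \<Rightarrow> real) \<Rightarrow> nat set \<Rightarrow> nat \<Rightarrow> real" where
  "kth_largest f S m = rev (sort (map f (sorted_list_of_set S))) ! (m - 1)"

definition eps_top :: "nat \<Rightarrow> nat \<Rightarrow> (nat \<Rightarrow> real) \<Rightarrow> real \<Rightarrow> nat \<Rightarrow> bool" where
  "eps_top n m \<mu> \<epsilon> i \<longleftrightarrow> \<mu> i \<ge> kth_largest \<mu> {..<n} m - \<epsilon>"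

definition solves :: "nat \<Rightarrow> nat \<Rightarrow> (nat \<Rightarrow> real) \<Rightarrow> real \<Rightarrow> real \<Rightarrow> real measure
                      \<Rightarrow> (real \<Rightarrow> (nat \<times> real) list \<Rightarrow> action) \<Rightarrow> bool" where
  "solves n m s \<epsilon> \<delta> R alg \<longleftrightarrow>
     (\<forall>\<nu>. bandit_instance n s \<nu> \<longrightarrow>
        measure (sample_space n R \<nu>)
          {p \<in> space (sample_space n R \<nu>).
             (\<exists>t. stopped alg (fst p) (snd p) t) \<and>
             alg_output alg (fst p) (snd p) \<subseteq> {..<n} \<and>
             card (alg_output alg (fst p) (snd p)) = m \<and>
             (\<forall>i\<in>alg_output alg (fst p) (snd p). eps_top n m (arm_mean \<nu>) \<epsilon> i)}
        \<ge> 1 - \<delta>)"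

definition Ent :: "(nat \<Rightarrow> real) \<Rightarrow> nat set \<Rightarrow> real" where
  "Ent a A = (let Z = (\<Sum>j\<in>A. a j) in - (\<Sum>i\<in>A. (a i / Z) * ln (a i / Z)))"

definition smin :: "nat \<Rightarrow> (nat \<Rightarrow> real) \<Rightarrow> real" where
  "smin n s = Min (s ` {..<n})"

definition grp :: "nat \<Rightarrow> (nat \<Rightarrow> real) \<Rightarrow> nat \<Rightarrow> nat set" where
  "grp n s j = {i\<in>{..<n}. (2::real) ^ (j - 1) \<le> s i / smin n s \<and> s i / smin n s < 2 ^ j}"

definition Gm :: "nat \<Rightarrow> nat \<Rightarrow> (nat \<Rightarrow> real) \<Rightarrow> nat set" where
  "Gm n m s = (\<Union>j\<in>{j. 1 \<le> j \<and> card (grp n s j) > 2 * m}. grp n s j)"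

definition Gl :: "nat \<Rightarrow> nat \<Rightarrow> (nat \<Rightarrow> real) \<Rightarrow> nat set" where
  "Gl n m s = (\<Union>j\<in>{j. 1 \<le> j \<and> card (grp n s j) \<le> 2 * m}. grp n s j)"

definition valid_Gr :: "nat \<Rightarrow> nat \<Rightarrow> (nat \<Rightarrow> real) \<Rightarrow> nat set \<Rightarrow> bool" where
  "valid_Gr n m s A \<longleftrightarrow> A \<subseteq> {..<n} \<and>
     (\<forall>j\<ge>1. if card (grp n s j) \<le> 2 * m then A \<inter> grp n s j = grp n s j
            else card (A \<inter> grp n s j) = 2 * m)"

definition Ent_Gr :: "nat \<Rightarrow> nat \<Rightarrow> (nat \<Rightarrow> real) \<Rightarrow> real" where
  "Ent_Gr n m s = Max (Ent s ` {A. valid_Gr n m s A})"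

end

theory Submission
  imports Defs
begin

text \<open>All hard instances are Gaussian. If two of them differ by \<Delta> in the mean of a single
  arm a, then on the event that the algorithm has pulled a exactly j times, the law P satisfies
  dP^2 = exp (j \<Delta>^2 / s a) dP' dP'', where P' and P'' are the laws with the mean of a shifted by
  +\<Delta> and -\<Delta>. Hence an output that is likely under P and has probability at most q under P'
  forces about s a / \<Delta>^2 * ln (1/q) expected pulls of a.

  The confidence term comes from an instance on which every arm has a shift that invalidates the only
  correct answer. For the other two terms, consider the instances in which a set S of m arms has
  mean 4 \<epsilon> and all other arms have mean 0, so that S must be returned. Making an arm a good as
  well leads to a set T of m + 1 good arms, and the events that T - {a} is returned, for a in T, are
  disjoint. So their probabilities q_T(a) sum to at most 1, and averaging
  s a * ln (1 / q_T(a)) over S with weights w turns, by Gibbs' inequality, into the entropy of the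
  weights w(T - {a}) * s a. With w(S) the product of the s i over S these are constant on T, which
  gives ln (m + 1) times the total variance outside the m most variable arms; with w = 1 on the
  subsets of a set H of 2 m + 1 arms they give the entropy of H. The groups enter
  only through the inequality that bounds the claimed expression by these three quantities.\<close>

section \<open>Change of measure for Gaussian sequences\<close>

definition gauss :: "real \<Rightarrow> real \<Rightarrow> real measure" where
  "gauss \<mu> v = density lborel (\<lambda>x. ennreal (normal_density \<mu> (sqrt v) x))"

lemma prob_space_gauss: "0 < v \<Longrightarrow> prob_space (gauss \<mu> v)"
  unfolding gauss_def by (rule prob_space_normal_density) simp

lemma sets_gauss [measurable_cong, simp]: "sets (gauss \<mu> v) = sets borel"
  by (simp add: gauss_def)

text \<open>In the sum of the two exponents the terms linear in \<open>\<Delta>\<close> cancel, so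
  the product of the shifted densities is the squared density up to a factor independent of
  \<open>y\<close>. This is the one-reward case of the identity between the three laws.\<close>

lemma normal_density_mult_shift:
  assumes "0 < v"
  shows "normal_density (\<mu> + \<Delta>) (sqrt v) y * normal_density (\<mu> - \<Delta>) (sqrt v) y =
    exp (- (\<Delta>\<^sup>2 / v)) * (normal_density \<mu> (sqrt v) y)\<^sup>2"
proof -
  define c where "c = 1 / sqrt (2 * pi * v)"
  have nd: "normal_density a (sqrt v) y = c * exp (- (y - a)\<^sup>2 / (2 * v))" for a
    using assms by (simp add: normal_density_def c_def)
  have e: "- (y - (\<mu> + \<Delta>))\<^sup>2 / (2 * v) + - (y - (\<mu> - \<Delta>))\<^sup>2 / (2 * v) =
    - (\<Delta>\<^sup>2 / v) + (- (y - \<mu>)\<^sup>2 / (2 * v) + - (y - \<mu>)\<^sup>2 / (2 * v))"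
    using assms by (simp add: field_simps power2_eq_square)
  have "normal_density (\<mu> + \<Delta>) (sqrt v) y * normal_density (\<mu> - \<Delta>) (sqrt v) y = c\<^sup>2 *
    exp (- (y - (\<mu> + \<Delta>))\<^sup>2 / (2 * v) + - (y - (\<mu> - \<Delta>))\<^sup>2 / (2 * v))"
    unfolding nd exp_add by (simp add: power2_eq_square[of c] ac_simps)
  also have "\<dots> = exp (- (\<Delta>\<^sup>2 / v)) * (normal_density \<mu> (sqrt v) y)\<^sup>2"
    unfolding nd e exp_add by (simp add: power_mult_distrib power2_eq_square[of "exp _"] ac_simps)
  finally show ?thesis .
qed

text \<open>Tilting the density by \<open>exp (l * (x - \<mu>))\<close> gives, up to the factor
  \<open>exp (v * l\<^sup>2 / 2)\<close>, the Gaussian density with mean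
  \<open>\<mu> + v * l\<close>. So a Gaussian meets the sub-Gaussian condition with
  equality.\<close>

lemma gauss_mgf:
  assumes "0 < v"
  shows "has_bochner_integral (gauss \<mu> v) (\<lambda>x. exp (l * (x - \<mu>))) (exp (v * l\<^sup>2 / 2))"
proof -
  have e: "normal_density \<mu> (sqrt v) x * exp (l * (x - \<mu>)) =
    exp (v * l\<^sup>2 / 2) * normal_density (\<mu> + v * l) (sqrt v) x" for x
  proof -
    have "- (x - \<mu>)\<^sup>2 / (2 * v) + l * (x - \<mu>) =
      v * l\<^sup>2 / 2 + - (x - (\<mu> + v * l))\<^sup>2 / (2 * v)"
      using assms by (simp add: field_simps power2_eq_square)
    then have "exp (- (x - \<mu>)\<^sup>2 / (2 * v)) * exp (l * (x - \<mu>)) =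
      exp (v * l\<^sup>2 / 2) * exp (- (x - (\<mu> + v * l))\<^sup>2 / (2 * v))"
      unfolding exp_add[symmetric] by simp
    then show ?thesis
      using assms by (simp add: normal_density_def)
  qed
  have "has_bochner_integral lborel
    (\<lambda>x. exp (v * l\<^sup>2 / 2) * normal_density (\<mu> + v * l) (sqrt v) x) (exp (v * l\<^sup>2 / 2) * 1)"
    using assms by (intro has_bochner_integral_mult_right) (simp add: has_bochner_integral_iff)
  then show ?thesis
    unfolding gauss_def
    by (intro has_bochner_integral_density) (auto simp: e)
qed

lemma gauss_mean:
  assumes "0 < v"
  shows "has_bochner_integral (gauss \<mu> v) (\<lambda>x. x) \<mu>"
  unfolding gauss_def using assms
  by (intro has_bochner_integral_density) (auto intro: normal_moment_nz_1)

text \<open>The induction on j applies the hypothesis for the tail of the sequence with the weight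
  r scaled by the likelihood ratio of the first reward.\<close>

lemma gauss_sequence_change_of_measure:
  fixes f :: "(nat \<Rightarrow> real) \<Rightarrow> ennreal" and j :: nat
  assumes v: "0 < v"
    and "f \<in> borel_measurable (\<Pi>\<^sub>M k\<in>(UNIV::nat set). (borel :: real measure))"
    and "\<And>Y Y'. (\<And>k. k < j \<Longrightarrow> Y k = Y' k) \<Longrightarrow> f Y = f Y'"
    and "0 < r"
  shows "2 * (\<integral>\<^sup>+Y. f Y \<partial>(\<Pi>\<^sub>M k\<in>(UNIV::nat set). gauss \<mu> v)) \<le>
    ennreal (exp (j * (\<Delta>\<^sup>2 / v) / 2)) *
     (ennreal r * (\<integral>\<^sup>+Y. f Y \<partial>(\<Pi>\<^sub>M k\<in>(UNIV::nat set). gauss (\<mu> + \<Delta>) v)) +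
      ennreal (1 / r) * (\<integral>\<^sup>+Y. f Y \<partial>(\<Pi>\<^sub>M k\<in>(UNIV::nat set). gauss (\<mu> - \<Delta>) v)))"
  using assms(2-)
proof (induction j arbitrary: f r)
  case 0
  have f: "f Y = f (\<lambda>_. 0)" for Y
    by (rule 0(2)) simp
  have I: "(\<integral>\<^sup>+Y. f Y \<partial>(\<Pi>\<^sub>M k\<in>(UNIV::nat set). gauss a v)) = f (\<lambda>_. 0)" for a
  proof -
    interpret product_prob_space "\<lambda>_. gauss a v" "UNIV :: nat set"
      by (simp add: product_prob_spaceI prob_space_gauss v)
    show ?thesis
      by (subst f) (simp add: emeasure_space_1)
  qed
  \<comment> \<open>With no reward observed the three integrals coincide, and what remains is the
    inequality of arithmetic and geometric means, with \<open>r\<close> as its free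
    parameter.\<close>
  have "2 \<le> r + 1 / r"
    using \<open>0 < r\<close> sum_squares_bound[of r 1] by (simp add: field_simps power2_eq_square)
  then have "ennreal 2 * f (\<lambda>_. 0) \<le> ennreal (r + 1 / r) * f (\<lambda>_. 0)"
    by (intro mult_right_mono) (auto simp: ennreal_le_iff2)
  with \<open>0 < r\<close> show ?case
    by (simp add: I ennreal_plus distrib_right del: ennreal_plus[symmetric])
next
  case (Suc j)
  let ?P = "\<Pi>\<^sub>M k\<in>(UNIV::nat set). (borel :: real measure)"
  let ?S = "\<lambda>a. \<Pi>\<^sub>M k\<in>(UNIV::nat set). gauss a v"
  let ?n = "\<lambda>a y. normal_density a (sqrt v) y"
  let ?D = "\<Delta>\<^sup>2 / v"
  note [measurable] = Suc.prems(1)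
  have fm [measurable]: "f \<in> borel_measurable (?S a)" for a
    using Suc.prems(1) by (simp cong: measurable_cong_sets sets_PiM_cong)
  have fc [measurable]: "(\<lambda>p. f (case_nat (fst p) (snd p))) \<in> borel_measurable (borel \<Otimes>\<^sub>M ?P)"
    by measurable
  define g where "g a y = (\<integral>\<^sup>+Y. f (case_nat y Y) \<partial>?S a)" for a y
  have pos: "0 < ?n a y" for a y
    using v by (simp add: normal_density_pos)
  have gm [measurable]: "g a \<in> borel_measurable borel" for a
  proof -
    interpret prob_space "?S a"
      by (intro prob_space_PiM prob_space_gauss v)
    have "(\<lambda>p. f (case_nat (fst p) (snd p))) \<in> borel_measurable (borel \<Otimes>\<^sub>M ?S a)"
      using fc by (simp cong: measurable_cong_sets sets_PiM_cong sets_pair_measure_cong)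
    then show ?thesis
      unfolding g_def by (intro borel_measurable_nn_integral) (simp add: split_beta')
  qed
  have iter: "(\<integral>\<^sup>+Y. f Y \<partial>?S a) = (\<integral>\<^sup>+y. ennreal (?n a y) * g a y \<partial>lborel)" for a
  proof -
    interpret sequence_space "gauss a v"
      by (simp add: sequence_space_def product_prob_spaceI prob_space_gauss v)
    interpret G: prob_space "gauss a v"
      by (simp add: prob_space_gauss v)
    have fc': "(\<lambda>p. f (case_nat (fst p) (snd p))) \<in> borel_measurable (gauss a v \<Otimes>\<^sub>M ?S a)"
      using fc by (simp cong: measurable_cong_sets sets_PiM_cong sets_pair_measure_cong)
    have "(\<integral>\<^sup>+Y. f Y \<partial>?S a) =
      (\<integral>\<^sup>+Y. f Y \<partial>distr (gauss a v \<Otimes>\<^sub>M ?S a) (?S a) (\<lambda>(s, \<omega>). case_nat s \<omega>))"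
      by (simp add: PiM_iter)
    also have "\<dots> = (\<integral>\<^sup>+p. f (case_nat (fst p) (snd p)) \<partial>(gauss a v \<Otimes>\<^sub>M ?S a))"
      by (subst nn_integral_distr) (auto simp: split_beta')
    also have "\<dots> = (\<integral>\<^sup>+y. g a y \<partial>gauss a v)"
      unfolding g_def by (subst nn_integral_fst[symmetric, OF fc']) simp
    also have "\<dots> = (\<integral>\<^sup>+y. ennreal (?n a y) * g a y \<partial>lborel)"
      unfolding gauss_def by (subst nn_integral_density) auto
    finally show ?thesis .
  qed
  have step: "2 * (ennreal (?n \<mu> y) * g \<mu> y) \<le> ennreal (exp (Suc j * ?D / 2)) *
     (ennreal r * (ennreal (?n (\<mu> + \<Delta>) y) * g (\<mu> + \<Delta>) y) +
      ennreal (1 / r) * (ennreal (?n (\<mu> - \<Delta>) y) * g (\<mu> - \<Delta>) y))" for y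
  proof -
    \<comment> \<open>With this choice \<open>?n \<mu> y * \<kappa>\<close> and
      \<open>?n \<mu> y / \<kappa>\<close> are the same multiple \<open>exp (?D / 2)\<close> of the
      two shifted densities, weighted by \<open>r\<close> and \<open>1 / r\<close>. The multiple
      accounts for the additional reward.\<close>
    define \<kappa> where "\<kappa> = r * exp (?D / 2) * ?n (\<mu> + \<Delta>) y / ?n \<mu> y"
    have \<kappa>: "0 < \<kappa>"
      using pos \<open>0 < r\<close> by (simp add: \<kappa>_def)
    have "(\<lambda>Y. f (case_nat y Y)) \<in> borel_measurable ?P"
      by measurable
    moreover have "f (case_nat y Y) = f (case_nat y Y')" if "\<And>k. k < j \<Longrightarrow> Y k = Y' k" for Y Y'
      using that by (intro Suc.prems(2)) (auto split: nat.split)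
    ultimately have ih: "2 * g \<mu> y \<le> ennreal (exp (j * ?D / 2)) *
     (ennreal \<kappa> * g (\<mu> + \<Delta>) y + ennreal (1 / \<kappa>) * g (\<mu> - \<Delta>) y)"
      unfolding g_def using \<kappa> by (rule Suc.IH)
    have r1: "?n \<mu> y * \<kappa> = exp (?D / 2) * (r * ?n (\<mu> + \<Delta>) y)"
      using pos[of \<mu> y] by (simp add: \<kappa>_def)
    have "?n (\<mu> + \<Delta>) y * ?n (\<mu> - \<Delta>) y * (exp (?D / 2) * exp (?D / 2)) = (?n \<mu> y)\<^sup>2"
      unfolding normal_density_mult_shift[OF v] by (simp add: mult_exp_exp flip: exp_minus)
    then have r2: "?n \<mu> y * (1 / \<kappa>) = exp (?D / 2) * ((1 / r) * ?n (\<mu> - \<Delta>) y)"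
      using pos[of \<mu> y] pos[of "\<mu> + \<Delta>" y] \<open>0 < r\<close>
      by (simp add: \<kappa>_def field_simps power2_eq_square)
    have ex: "exp (Suc j * ?D / 2) = exp (j * ?D / 2) * exp (?D / 2)"
      by (simp add: exp_add[symmetric] add_divide_distrib distrib_right)
    have "2 * (ennreal (?n \<mu> y) * g \<mu> y) = ennreal (?n \<mu> y) * (2 * g \<mu> y)"
      by (simp add: ac_simps)
    also have "\<dots> \<le> ennreal (?n \<mu> y) * (ennreal (exp (j * ?D / 2)) *
     (ennreal \<kappa> * g (\<mu> + \<Delta>) y + ennreal (1 / \<kappa>) * g (\<mu> - \<Delta>) y))"
      by (intro mult_left_mono ih) simp
    also have "\<dots> = ennreal (exp (j * ?D / 2)) *
     (ennreal (?n \<mu> y * \<kappa>) * g (\<mu> + \<Delta>) y + ennreal (?n \<mu> y * (1 / \<kappa>)) * g (\<mu> - \<Delta>) y)"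
      unfolding ennreal_mult'[OF normal_density_nonneg] by (simp only: distrib_left ac_simps)
    also have "\<dots> = ennreal (exp (Suc j * ?D / 2)) *
     (ennreal r * (ennreal (?n (\<mu> + \<Delta>) y) * g (\<mu> + \<Delta>) y) +
      ennreal (1 / r) * (ennreal (?n (\<mu> - \<Delta>) y) * g (\<mu> - \<Delta>) y))"
      unfolding r1 r2 ex ennreal_mult'[OF exp_ge_zero] ennreal_mult''[OF normal_density_nonneg]
      by (simp only: distrib_left ac_simps)
    finally show ?thesis .
  qed
  have "2 * (\<integral>\<^sup>+Y. f Y \<partial>?S \<mu>) = (\<integral>\<^sup>+y. 2 * (ennreal (?n \<mu> y) * g \<mu> y) \<partial>lborel)"
    unfolding iter by (subst nn_integral_cmult) auto
  also have "\<dots> \<le> (\<integral>\<^sup>+y. ennreal (exp (Suc j * ?D / 2)) *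
     (ennreal r * (ennreal (?n (\<mu> + \<Delta>) y) * g (\<mu> + \<Delta>) y) +
      ennreal (1 / r) * (ennreal (?n (\<mu> - \<Delta>) y) * g (\<mu> - \<Delta>) y)) \<partial>lborel)"
    by (intro nn_integral_mono step)
  also have "\<dots> = ennreal (exp (Suc j * ?D / 2)) *
     (ennreal r * (\<integral>\<^sup>+Y. f Y \<partial>?S (\<mu> + \<Delta>)) + ennreal (1 / r) * (\<integral>\<^sup>+Y. f Y \<partial>?S (\<mu> - \<Delta>)))"
    unfolding iter by (simp add: nn_integral_cmult nn_integral_add)
  finally show ?case .
qed

section \<open>Adaptive algorithms on Gaussian instances\<close>

text \<open>An index outside the range gets a standard Gaussian, so that every component is a
  probability measure and the product-space locales apply without a side condition on the
  index.\<close>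

definition gauss_inst :: "nat \<Rightarrow> (nat \<Rightarrow> real) \<Rightarrow> (nat \<Rightarrow> real) \<Rightarrow> nat \<Rightarrow> real measure" where
  "gauss_inst n s \<mu> i = (if i < n then gauss (\<mu> i) (s i) else gauss 0 1)"

lemma arm_mean_gauss_inst:
  assumes "i < n" "0 < s i"
  shows "arm_mean (gauss_inst n s \<mu>) i = \<mu> i"
  using gauss_mean[OF assms(2)] assms(1)
  by (simp add: arm_mean_def gauss_inst_def has_bochner_integral_iff)

lemma bandit_instance_gauss_inst:
  assumes "\<And>i. i < n \<Longrightarrow> 0 < s i"
  shows "bandit_instance n s (gauss_inst n s \<mu>)"
  unfolding bandit_instance_def
proof (intro allI impI conjI)
  fix i l assume i: "i < n"
  note s = assms[OF i]
  show "prob_space (gauss_inst n s \<mu> i)" "sets (gauss_inst n s \<mu> i) = sets borel"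
    using i s by (simp_all add: gauss_inst_def prob_space_gauss)
  show "integrable (gauss_inst n s \<mu> i) (\<lambda>x. x)"
    using i gauss_mean[OF s] by (simp add: gauss_inst_def has_bochner_integral_iff)
  show "integrable (gauss_inst n s \<mu> i) (\<lambda>x. exp (l * (x - arm_mean (gauss_inst n s \<mu>) i)))"
    "ln (\<integral>x. exp (l * (x - arm_mean (gauss_inst n s \<mu>) i)) \<partial>(gauss_inst n s \<mu> i)) \<le> s i * l\<^sup>2 / 2"
    using i gauss_mgf[OF s, of "\<mu> i" l]
    by (simp_all add: arm_mean_gauss_inst[of i n s, OF i s])
      (simp_all add: gauss_inst_def has_bochner_integral_iff)
qed

text \<open>The algorithm reacts only to samples that it has drawn, and those drawn up to
  \<open>t\<close> are among those drawn up to \<open>Suc t\<close>. Consequently the event of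
  exactly j pulls of \<open>a\<close> up to a given time depends only on the first j samples of
  \<open>a\<close>.\<close>

lemma hist_cong:
  assumes "\<And>k. k < length (filter (\<lambda>p. fst p = a) (hist alg \<omega> X t)) \<Longrightarrow> X a k = X' a k"
    and "\<And>i. i \<noteq> a \<Longrightarrow> X i = X' i"
  shows "hist alg \<omega> X t = hist alg \<omega> X' t"
  using assms(1)
proof (induction t)
  case 0
  then show ?case by simp
next
  case (Suc t)
  have le: "length (filter (\<lambda>p. fst p = a) (hist alg \<omega> X t))
      \<le> length (filter (\<lambda>p. fst p = a) (hist alg \<omega> X (Suc t)))"
    by (simp split: action.split)
  have eq: "hist alg \<omega> X t = hist alg \<omega> X' t"
    using le by (intro Suc.IH Suc.prems) simp
  show ?case
  proof (cases "alg \<omega> (hist alg \<omega> X t)")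
    case (Pull i)
    have "X i (length (filter (\<lambda>p. fst p = i) (hist alg \<omega> X t)))
        = X' i (length (filter (\<lambda>p. fst p = i) (hist alg \<omega> X t)))"
    proof (cases "i = a")
      case True
      with Pull Suc.prems show ?thesis by simp
    qed (simp add: assms(2))
    with Pull show ?thesis by (simp add: eq[symmetric])
  qed (simp add: eq[symmetric])
qed

lemma hist_stopped:
  assumes "alg \<omega> (hist alg \<omega> X t) = Stop S" "t \<le> u"
  shows "hist alg \<omega> X u = hist alg \<omega> X t"
  using assms(2,1) by (induction u rule: dec_induct) auto

lemma length_hist: "length (hist alg \<omega> X t) \<le> t"
  by (induction t) (auto split: action.split intro: le_SucI)

lemma length_hist_le_num_samples:
  "of_nat (length (hist alg \<omega> X t)) \<le> num_samples alg \<omega> X"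
proof (cases "\<exists>t. stopped alg \<omega> X t")
  case True
  define u where "u = (LEAST t. stopped alg \<omega> X t)"
  have "stopped alg \<omega> X u"
    using True unfolding u_def by (rule LeastI_ex)
  then obtain S where S: "alg \<omega> (hist alg \<omega> X u) = Stop S"
    by (auto simp: stopped_def)
  have "length (hist alg \<omega> X t) \<le> u"
  proof (cases "t \<le> u")
    case True
    then show ?thesis using length_hist[of alg \<omega> X t] by simp
  next
    case False
    then show ?thesis using hist_stopped[of alg \<omega> X u S t] S length_hist[of alg \<omega> X u] by simp
  qed
  then show ?thesis
    using True by (simp add: num_samples_def u_def)
qed (simp add: num_samples_def)

text \<open>The history is frozen after the first stopping time, so any time at which the algorithm
  has stopped shows its output. This removes \<open>LEAST\<close> from later arguments about the
  output.\<close>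

lemma alg_output_eq:
  assumes "alg \<omega> (hist alg \<omega> X t) = Stop S"
  shows "alg_output alg \<omega> X = S"
proof -
  define u where "u = (LEAST t. stopped alg \<omega> X t)"
  have st: "stopped alg \<omega> X t"
    using assms by (auto simp: stopped_def)
  then have "stopped alg \<omega> X u"
    unfolding u_def by (rule LeastI)
  then obtain S' where S': "alg \<omega> (hist alg \<omega> X u) = Stop S'"
    by (auto simp: stopped_def)
  have "u \<le> t"
    unfolding u_def using st by (rule Least_le)
  with S' have "hist alg \<omega> X t = hist alg \<omega> X u"
    by (intro hist_stopped)
  with S' assms show ?thesis
    by (simp add: alg_output_def u_def)
qed

lemma sum_length_filter_fst_le:
  "finite A \<Longrightarrow> (\<Sum>a\<in>A. length (filter (\<lambda>p. fst p = a) xs)) \<le> length xs"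
proof (induction xs)
  case (Cons x xs)
  have "(\<Sum>a\<in>A. length (filter (\<lambda>p. fst p = a) (x # xs))) =
    (\<Sum>a\<in>A. length (filter (\<lambda>p. fst p = a) xs)) + (\<Sum>a\<in>A. if fst x = a then 1 else 0)"
    unfolding sum.distrib[symmetric] by (intro sum.cong) auto
  also have "(\<Sum>a\<in>A. if fst x = a then 1 else 0) \<le> (1::nat)"
    using Cons.prems by simp
  finally show ?case using Cons by simp
qed simp

section \<open>Laws, pull counts and output events of an algorithm on Gaussian instances\<close>

locale bandit =
  fixes n :: nat and s :: "nat \<Rightarrow> real" and R :: "real measure"
    and alg :: "real \<Rightarrow> (nat \<times> real) list \<Rightarrow> action"
  assumes s_pos: "i < n \<Longrightarrow> 0 < s i"
    and prob_R: "prob_space R" and sets_R [measurable_cong]: "sets R = sets borel"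
    and alg_meas: "alg_measurable n alg"
begin

text \<open>One sigma-algebra, built from \<open>borel\<close> alone, is shared by the laws for all
  means, so that an event is measurable under each of them at once.\<close>

abbreviation table :: "(real \<times> (nat \<Rightarrow> nat \<Rightarrow> real)) measure" where
  "table \<equiv> borel \<Otimes>\<^sub>M (\<Pi>\<^sub>M i\<in>{..<n}. \<Pi>\<^sub>M k\<in>(UNIV::nat set). (borel :: real measure))"

definition P :: "(nat \<Rightarrow> real) \<Rightarrow> (real \<times> (nat \<Rightarrow> nat \<Rightarrow> real)) measure" where
  "P \<mu> = sample_space n R (gauss_inst n s \<mu>)"

definition pulls_before :: "nat \<Rightarrow> nat \<Rightarrow> real \<times> (nat \<Rightarrow> nat \<Rightarrow> real) \<Rightarrow> nat" where
  "pulls_before a t p = length (filter (\<lambda>q. fst q = a) (hist alg (fst p) (snd p) t))"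

definition pulls :: "nat \<Rightarrow> real \<times> (nat \<Rightarrow> nat \<Rightarrow> real) \<Rightarrow> ennreal" where
  "pulls a p = (SUP t. of_nat (pulls_before a t p))"

text \<open>The stop may have occurred before \<open>t\<close>, since a stopped algorithm keeps its
  history and repeats its action. The events therefore increase with \<open>t\<close>.\<close>

definition returns_by :: "nat \<Rightarrow> nat set set \<Rightarrow> (real \<times> (nat \<Rightarrow> nat \<Rightarrow> real)) set" where
  "returns_by t \<O> = {p \<in> space table. alg (fst p) (hist alg (fst p) (snd p) t) \<in> Stop ` \<O>}"

definition returns :: "nat set set \<Rightarrow> (real \<times> (nat \<Rightarrow> nat \<Rightarrow> real)) set" where
  "returns \<O> = (\<Union>t. returns_by t \<O>)"

lemma prob_gauss_inst: "prob_space (gauss_inst n s \<mu> i)"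
  using s_pos by (simp add: gauss_inst_def prob_space_gauss)

lemma sets_gauss_inst [measurable_cong]: "sets (gauss_inst n s \<mu> i) = sets borel"
  by (simp add: gauss_inst_def)

lemma prob_space_sequence: "prob_space (\<Pi>\<^sub>M k\<in>(UNIV::nat set). gauss_inst n s \<mu> i)"
  by (intro prob_space_PiM prob_gauss_inst)

lemma sets_P [measurable_cong, simp]: "sets (P \<mu>) = sets table"
  unfolding P_def sample_space_def
  by (intro sets_pair_measure_cong sets_PiM_cong sets_R sets_gauss_inst refl)

lemma space_P [simp]: "space (P \<mu>) = space table"
  by (rule sets_eq_imp_space_eq) simp

lemma prob_space_P: "prob_space (P \<mu>)"
proof -
  interpret R: prob_space R by (rule prob_R)
  interpret X: prob_space "\<Pi>\<^sub>M i\<in>{..<n}. \<Pi>\<^sub>M k\<in>(UNIV::nat set). gauss_inst n s \<mu> i"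
    by (intro prob_space_PiM prob_gauss_inst)
  interpret pair_prob_space R "\<Pi>\<^sub>M i\<in>{..<n}. \<Pi>\<^sub>M k\<in>(UNIV::nat set). gauss_inst n s \<mu> i" ..
  show ?thesis
    unfolding P_def sample_space_def by unfold_locales
qed

sublocale P: prob_space "P \<mu>" for \<mu>
  by (rule prob_space_P)

lemma measurable_action [measurable]:
  "(\<lambda>p. alg (fst p) (hist alg (fst p) (snd p) t)) \<in> table \<rightarrow>\<^sub>M count_space UNIV"
  using alg_meas unfolding alg_measurable_def by (simp add: split_beta')

lemma returns_by_measurable [measurable]: "returns_by t \<O> \<in> sets table"
  using measurable_sets[OF measurable_action, of "Stop ` \<O>"]
  by (simp add: returns_by_def vimage_def Int_def conj_commute)

lemma returns_measurable [measurable]: "returns \<O> \<in> sets table"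
  unfolding returns_def by measurable

lemma pulls_before_Suc:
  "pulls_before a (Suc t) p =
    pulls_before a t p + (if alg (fst p) (hist alg (fst p) (snd p) t) = Pull a then 1 else 0)"
  by (simp add: pulls_before_def split: action.split)

lemma pulls_before_measurable [measurable]: "pulls_before a t \<in> table \<rightarrow>\<^sub>M count_space UNIV"
proof (induction t)
  case 0
  have "pulls_before a 0 = (\<lambda>_. 0)"
    by (auto simp: pulls_before_def)
  then show ?case by simp
next
  case (Suc t)
  note [measurable] = Suc
  show ?case
    unfolding pulls_before_Suc[abs_def] by measurable
qed

lemma pulls_measurable [measurable]: "pulls a \<in> borel_measurable table"
  unfolding pulls_def[abs_def] by measurable

lemma pulls_before_mono: "t \<le> u \<Longrightarrow> pulls_before a t p \<le> pulls_before a u p"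
  by (rule lift_Suc_mono_le[of "\<lambda>t. pulls_before a t p"]) (auto simp: pulls_before_Suc)

lemma incseq_returns_by: "incseq (\<lambda>t. returns_by t \<O>)"
  by (rule incseq_SucI) (auto simp: returns_by_def)

text \<open>Pull counts increase in time, so the supremum commutes with the finite sum over arms,
  and at each time the counts add up to at most the length of the history.\<close>

lemma sum_pulls_le_expected_samples:
  "(\<Sum>a<n. \<integral>\<^sup>+p. pulls a p \<partial>P \<mu>) \<le> expected_samples n R (gauss_inst n s \<mu>) alg"
proof -
  have "(\<Sum>a<n. pulls a p) \<le> num_samples alg (fst p) (snd p)" for p
  proof -
    have "(\<Sum>a<n. pulls a p) = (SUP t. \<Sum>a<n. of_nat (pulls_before a t p))"
      unfolding pulls_def
      by (intro ennreal_SUP_sum[symmetric]) (auto simp: incseq_def intro: pulls_before_mono)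
    also have "\<dots> \<le> num_samples alg (fst p) (snd p)"
    proof (rule SUP_least)
      fix t
      have "(\<Sum>a<n. of_nat (pulls_before a t p)) \<le> (of_nat (length (hist alg (fst p) (snd p) t)) :: ennreal)"
        unfolding pulls_before_def of_nat_sum[symmetric] of_nat_le_iff
        by (rule sum_length_filter_fst_le) simp
      also note length_hist_le_num_samples
      finally show "(\<Sum>a<n. of_nat (pulls_before a t p)) \<le> num_samples alg (fst p) (snd p)" .
    qed
    finally show ?thesis .
  qed
  then have "(\<integral>\<^sup>+p. (\<Sum>a<n. pulls a p) \<partial>P \<mu>) \<le> expected_samples n R (gauss_inst n s \<mu>) alg"
    unfolding expected_samples_def P_def by (intro nn_integral_mono)
  then show ?thesis
    by (subst (asm) nn_integral_sum) simp_all
qed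

text \<open>Puts the sample sequence of arm \<open>a\<close> into the innermost integral, the only
  one that a change of the mean of \<open>a\<close> affects.\<close>

lemma emeasure_P_disintegrate:
  assumes a: "a < n" and F: "F \<in> sets table"
  shows "emeasure (P \<mu>) F = (\<integral>\<^sup>+\<omega>. \<integral>\<^sup>+X. \<integral>\<^sup>+Y. indicator F (\<omega>, X(a := Y))
    \<partial>(\<Pi>\<^sub>M k\<in>(UNIV::nat set). gauss (\<mu> a) (s a))
    \<partial>(\<Pi>\<^sub>M i\<in>{..<n} - {a}. \<Pi>\<^sub>M k\<in>(UNIV::nat set). gauss_inst n s \<mu> i) \<partial>R)"
proof -
  let ?S = "\<lambda>i. \<Pi>\<^sub>M k\<in>(UNIV::nat set). gauss_inst n s \<mu> i"
  interpret product_sigma_finite ?S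
    by (intro product_sigma_finite.intro prob_space_imp_sigma_finite prob_space_sequence)
  interpret X: prob_space "\<Pi>\<^sub>M i\<in>{..<n}. ?S i"
    by (intro prob_space_PiM prob_gauss_inst)
  have F': "F \<in> sets (R \<Otimes>\<^sub>M (\<Pi>\<^sub>M i\<in>{..<n}. ?S i))"
    using F sets_P[of \<mu>] by (simp add: P_def sample_space_def)
  note [measurable] = F'
  have ins: "insert a ({..<n} - {a}) = {..<n}"
    using a by auto
  have "emeasure (P \<mu>) F = (\<integral>\<^sup>+p. indicator F p \<partial>(R \<Otimes>\<^sub>M (\<Pi>\<^sub>M i\<in>{..<n}. ?S i)))"
    using F' by (simp add: P_def sample_space_def)
  also have "\<dots> = (\<integral>\<^sup>+\<omega>. \<integral>\<^sup>+X. indicator F (\<omega>, X) \<partial>(\<Pi>\<^sub>M i\<in>{..<n}. ?S i) \<partial>R)"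
    by (rule X.nn_integral_fst[symmetric]) measurable
  also have "\<dots> = (\<integral>\<^sup>+\<omega>. \<integral>\<^sup>+X. \<integral>\<^sup>+Y. indicator F (\<omega>, X(a := Y)) \<partial>?S a
    \<partial>(\<Pi>\<^sub>M i\<in>{..<n} - {a}. ?S i) \<partial>R)"
  proof (rule nn_integral_cong)
    fix \<omega> assume "\<omega> \<in> space R"
    then have "(\<lambda>X. indicator F (\<omega>, X)) \<in> borel_measurable (\<Pi>\<^sub>M i\<in>{..<n}. ?S i)"
      by measurable
    then show "(\<integral>\<^sup>+X. indicator F (\<omega>, X) \<partial>(\<Pi>\<^sub>M i\<in>{..<n}. ?S i)) =
      (\<integral>\<^sup>+X. \<integral>\<^sup>+Y. indicator F (\<omega>, X(a := Y)) \<partial>?S a \<partial>(\<Pi>\<^sub>M i\<in>{..<n} - {a}. ?S i))"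
      using product_nn_integral_insert[of "{..<n} - {a}" a "\<lambda>X. indicator F (\<omega>, X)",
          unfolded ins]
      by simp
  qed
  finally show ?thesis
    using a by (simp add: gauss_inst_def)
qed

text \<open>The seed and the samples of the other arms have the same distribution under all three
  laws. The inequality for one Gaussian sequence holds for each of their values and is then
  integrated; much of the proof is the measurability of replacing column \<open>a\<close> of a
  table.\<close>

lemma emeasure_P_change_of_measure:
  assumes a: "a < n" and F: "F \<in> sets table" and "0 < r"
    and loc: "\<And>\<omega> X Y Y'. (\<And>k. k < j \<Longrightarrow> Y k = Y' k) \<Longrightarrow>
      (\<omega>, X(a := Y)) \<in> F \<longleftrightarrow> (\<omega>, X(a := Y')) \<in> F"
  shows "2 * emeasure (P \<mu>) F \<le> ennreal (exp (real j * (\<Delta>\<^sup>2 / s a) / 2)) *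
    (ennreal r * emeasure (P (\<mu>(a := \<mu> a + \<Delta>))) F +
     ennreal (1 / r) * emeasure (P (\<mu>(a := \<mu> a - \<Delta>))) F)"
proof -
  let ?S = "\<lambda>c. \<Pi>\<^sub>M k\<in>(UNIV::nat set). gauss c (s a)"
  let ?X = "\<Pi>\<^sub>M i\<in>{..<n} - {a}. \<Pi>\<^sub>M k\<in>(UNIV::nat set). gauss_inst n s \<mu> i"
  let ?C = "ennreal (exp (real j * (\<Delta>\<^sup>2 / s a) / 2))"
  define g where "g c \<omega> X = (\<integral>\<^sup>+Y. indicator F (\<omega>, X(a := Y)) \<partial>?S c)" for c \<omega> X
  have X_eq: "?X = (\<Pi>\<^sub>M i\<in>{..<n} - {a}. \<Pi>\<^sub>M k\<in>(UNIV::nat set). gauss_inst n s (\<mu>(a := c)) i)" for c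
    by (intro PiM_cong refl) (auto simp: gauss_inst_def)
  have eq: "emeasure (P (\<mu>(a := c))) F = (\<integral>\<^sup>+\<omega>. \<integral>\<^sup>+X. g c \<omega> X \<partial>?X \<partial>R)" for c
    using emeasure_P_disintegrate[OF a F, of "\<mu>(a := c)"] by (simp add: X_eq[of c] g_def)
  have eq0: "emeasure (P \<mu>) F = (\<integral>\<^sup>+\<omega>. \<integral>\<^sup>+X. g (\<mu> a) \<omega> X \<partial>?X \<partial>R)"
    using eq[of "\<mu> a"] by simp
  interpret X: prob_space ?X
    by (intro prob_space_PiM prob_gauss_inst)
  have ins: "insert a ({..<n} - {a}) = {..<n}"
    using a by auto
  have Fi: "(\<lambda>(p, Y). indicator F (fst p, (snd p)(a := Y)) :: ennreal) \<in> borel_measurable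
    ((R \<Otimes>\<^sub>M ?X) \<Otimes>\<^sub>M ?S c)" for c
  proof -
    have upd: "(\<lambda>q. (snd (fst q))(a := snd q)) \<in>
      (R \<Otimes>\<^sub>M ?X) \<Otimes>\<^sub>M ?S c \<rightarrow>\<^sub>M (\<Pi>\<^sub>M i\<in>{..<n}. \<Pi>\<^sub>M k\<in>(UNIV::nat set). (borel :: real measure))"
    proof (rule measurable_PiM_single')
      fix i assume i: "i \<in> {..<n}"
      show "(\<lambda>q. ((snd (fst q))(a := snd q)) i) \<in>
        (R \<Otimes>\<^sub>M ?X) \<Otimes>\<^sub>M ?S c \<rightarrow>\<^sub>M (\<Pi>\<^sub>M k\<in>(UNIV::nat set). (borel :: real measure))"
      proof (cases "i = a")
        case True
        have "snd \<in> (R \<Otimes>\<^sub>M ?X) \<Otimes>\<^sub>M ?S c \<rightarrow>\<^sub>M ?S c" by measurable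
        then show ?thesis
          using True by (simp cong: measurable_cong_sets sets_PiM_cong)
      next
        case False
        have "(\<lambda>q. snd (fst q)) \<in> (R \<Otimes>\<^sub>M ?X) \<Otimes>\<^sub>M ?S c \<rightarrow>\<^sub>M ?X" by measurable
        moreover have "(\<lambda>X. X i) \<in> ?X \<rightarrow>\<^sub>M (\<Pi>\<^sub>M k\<in>(UNIV::nat set). gauss_inst n s \<mu> i)"
          using i False by (intro measurable_component_singleton) auto
        then have "(\<lambda>X. X i) \<in> ?X \<rightarrow>\<^sub>M (\<Pi>\<^sub>M k\<in>(UNIV::nat set). (borel :: real measure))"
          unfolding measurable_cong_sets[OF refl sets_PiM_cong[OF refl sets_gauss_inst]] .
        ultimately have "(\<lambda>q. snd (fst q) i) \<in> (R \<Otimes>\<^sub>M ?X) \<Otimes>\<^sub>M ?S c \<rightarrow>\<^sub>M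
           (\<Pi>\<^sub>M k\<in>(UNIV::nat set). (borel :: real measure))"
          by (rule measurable_compose)
        then show ?thesis
          using False by simp
      qed
    next
      \<comment> \<open>Tables are extensional functions with value \<open>undefined\<close> outside
        \<open>{..<n}\<close>, and an update at \<open>a < n\<close> preserves this.\<close>
      have und: "snd (fst q) i = undefined"
        if "q \<in> space ((R \<Otimes>\<^sub>M ?X) \<Otimes>\<^sub>M ?S c)" "i \<notin> {..<n}" for q i
      proof -
        have "snd (fst q) \<in> space ?X"
          using that(1) by (auto simp: space_pair_measure)
        then show ?thesis
          using that(2) by (auto simp: space_PiM PiE_def extensional_def)
      qed
      show "(\<lambda>q. (snd (fst q))(a := snd q)) \<in> space ((R \<Otimes>\<^sub>M ?X) \<Otimes>\<^sub>M ?S c) \<rightarrow>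
        (\<Pi>\<^sub>E i\<in>{..<n}. space (\<Pi>\<^sub>M k\<in>(UNIV::nat set). (borel :: real measure)))"
      proof (intro Pi_I PiE_I)
        fix q i assume "q \<in> space ((R \<Otimes>\<^sub>M ?X) \<Otimes>\<^sub>M ?S c)" "i \<notin> {..<n}"
        then show "((snd (fst q))(a := snd q)) i = undefined"
          using und[of q i] a by auto
      qed (simp add: space_PiM)
    qed
    have fst_m: "(\<lambda>q. fst (fst q)) \<in> (R \<Otimes>\<^sub>M ?X) \<Otimes>\<^sub>M ?S c \<rightarrow>\<^sub>M borel"
      by measurable
    from measurable_Pair[OF fst_m upd]
    have "(\<lambda>q. indicator F (fst (fst q), (snd (fst q))(a := snd q)) :: ennreal) \<in> borel_measurable
      ((R \<Otimes>\<^sub>M ?X) \<Otimes>\<^sub>M ?S c)"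
      by (rule measurable_compose[OF _ borel_measurable_indicator[OF F]])
    then show ?thesis by (simp add: split_beta')
  qed
  have gm2: "(\<lambda>p. g c (fst p) (snd p)) \<in> borel_measurable (R \<Otimes>\<^sub>M ?X)" for c
  proof -
    interpret prob_space "?S c"
      using a s_pos by (intro prob_space_PiM prob_space_gauss)
    show ?thesis
      unfolding g_def by (intro borel_measurable_nn_integral Fi)
  qed
  have gm [measurable]: "g c \<omega> \<in> borel_measurable ?X" if "\<omega> \<in> space R" for c \<omega>
    using measurable_compose[OF measurable_Pair1'[OF that] gm2, of c] by simp
  have gm3 [measurable]: "(\<lambda>\<omega>. \<integral>\<^sup>+X. g c \<omega> X \<partial>?X) \<in> borel_measurable R" for c
    using gm2[of c] by (intro X.borel_measurable_nn_integral) (simp add: split_beta')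
  have step: "2 * g (\<mu> a) \<omega> X \<le>
    ?C * (ennreal r * g (\<mu> a + \<Delta>) \<omega> X + ennreal (1 / r) * g (\<mu> a - \<Delta>) \<omega> X)"
    if "\<omega> \<in> space R" "X \<in> space ?X" for \<omega> X
    unfolding g_def
  proof (rule gauss_sequence_change_of_measure)
    have "(\<lambda>Y. indicator F (\<omega>, X(a := Y)) :: ennreal) \<in> borel_measurable (?S 0)"
      using measurable_compose[OF measurable_Pair1' Fi[of 0], of "(\<omega>, X)"] that
      by (simp add: space_pair_measure)
    then show "(\<lambda>Y. indicator F (\<omega>, X(a := Y)) :: ennreal) \<in>
        borel_measurable (\<Pi>\<^sub>M k\<in>(UNIV::nat set). (borel :: real measure))"
      by (simp cong: measurable_cong_sets sets_PiM_cong)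
  next
    fix Y Y' :: "nat \<Rightarrow> real" assume "\<And>k. k < j \<Longrightarrow> Y k = Y' k"
    from loc[OF this] show "indicator F (\<omega>, X(a := Y)) = (indicator F (\<omega>, X(a := Y')) :: ennreal)"
      by (simp add: indicator_def)
  qed (use a s_pos \<open>0 < r\<close> in auto)
  have "2 * emeasure (P \<mu>) F = (\<integral>\<^sup>+\<omega>. \<integral>\<^sup>+X. 2 * g (\<mu> a) \<omega> X \<partial>?X \<partial>R)"
    unfolding eq0 by (simp add: nn_integral_cmult[symmetric] gm gm3 cong: nn_integral_cong)
  also have "\<dots> \<le> (\<integral>\<^sup>+\<omega>. \<integral>\<^sup>+X. ?C * (ennreal r * g (\<mu> a + \<Delta>) \<omega> X + ennreal (1 / r) * g (\<mu> a - \<Delta>) \<omega> X)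
    \<partial>?X \<partial>R)"
    by (intro nn_integral_mono step)
  also have "\<dots> = (\<integral>\<^sup>+\<omega>. ?C * (ennreal r * (\<integral>\<^sup>+X. g (\<mu> a + \<Delta>) \<omega> X \<partial>?X) +
     ennreal (1 / r) * (\<integral>\<^sup>+X. g (\<mu> a - \<Delta>) \<omega> X \<partial>?X)) \<partial>R)"
    by (intro nn_integral_cong) (simp add: nn_integral_cmult nn_integral_add gm)
  also have "\<dots> = ?C * (ennreal r * emeasure (P (\<mu>(a := \<mu> a + \<Delta>))) F +
     ennreal (1 / r) * emeasure (P (\<mu>(a := \<mu> a - \<Delta>))) F)"
    unfolding eq by (simp add: nn_integral_cmult nn_integral_add)
  finally show ?thesis .
qed

text \<open>Markov's inequality limits the pulls of \<open>a\<close> to about \<open>10 * B\<close>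
  at a cost of 1/10 in probability. What remains is split by the exact number of pulls, each piece
  is subjected to the change of measure, and the law with the opposite shift is bounded by
  1.\<close>

lemma transportation:
  assumes a: "a < n" and B: "0 \<le> B" "(\<integral>\<^sup>+p. pulls a p \<partial>P \<mu>) \<le> ennreal B"
    and hi: "9/10 < measure (P \<mu>) (returns \<O>)"
    and lo: "measure (P (\<mu>(a := \<mu> a + \<Delta>))) (returns \<O>) \<le> q"
  shows "16/25 \<le> q * exp (10 * B * (\<Delta>\<^sup>2 / s a))"
proof -
  note [measurable] = returns_by_measurable
  have "(\<lambda>t. measure (P \<mu>) (returns_by t \<O>)) \<longlonglongrightarrow> measure (P \<mu>) (returns \<O>)"
    unfolding returns_def by (intro P.finite_Lim_measure_incseq incseq_returns_by) auto
  \<comment> \<open>The strict inequality \<open>hi\<close> leaves room to keep only the part of the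
    event that is decided at a finite time \<open>t\<close>.\<close>
  from order_tendstoD(1)[OF this hi] obtain t where t: "9/10 < measure (P \<mu>) (returns_by t \<O>)"
    by (auto simp: eventually_sequentially)
  \<comment> \<open>More than \<open>K\<close> pulls means at least \<open>K + 1 > 10 * B\<close>,
    which by Markov's inequality has probability at most 1/10.\<close>
  define K where "K = nat \<lfloor>10 * B\<rfloor>"
  have K: "real K \<le> 10 * B" "10 * B < real K + 1"
    using B(1) by (auto simp: K_def)
  define many where "many = {p \<in> space table. K < pulls_before a t p}"
  have many_m [measurable]: "many \<in> sets table"
    unfolding many_def by measurable
  have "of_nat (Suc K) * emeasure (P \<mu>) many \<le> (\<integral>\<^sup>+p. pulls a p \<partial>P \<mu>)"
  proof -
    have "of_nat (Suc K) * emeasure (P \<mu>) many = (\<integral>\<^sup>+p. of_nat (Suc K) * indicator many p \<partial>P \<mu>)"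
      by (subst nn_integral_cmult_indicator) simp_all
    also have "\<dots> \<le> (\<integral>\<^sup>+p. pulls a p \<partial>P \<mu>)"
    proof (intro nn_integral_mono)
      fix p
      have "of_nat (pulls_before a t p) \<le> pulls a p"
        unfolding pulls_def by (rule SUP_upper) simp
      moreover have "of_nat (Suc K) \<le> (of_nat (pulls_before a t p) :: ennreal)" if "p \<in> many"
        using that unfolding many_def of_nat_le_iff by simp
      ultimately show "of_nat (Suc K) * indicator many p \<le> pulls a p"
        by (auto simp: indicator_def intro: order_trans)
    qed
    finally show ?thesis .
  qed
  with B(2) have "ennreal (real (Suc K) * measure (P \<mu>) many) \<le> ennreal B"
    by (simp add: P.emeasure_eq_measure ennreal_of_nat_eq_real_of_nat ennreal_mult'[symmetric]
      del: of_nat_Suc)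
  then have mk: "real (Suc K) * measure (P \<mu>) many \<le> B"
    using B(1) by (simp add: ennreal_le_iff)
  have many_le: "measure (P \<mu>) many \<le> 1/10"
  proof -
    have "B \<le> real (Suc K) * (1/10)"
      using K by simp
    with mk have "real (Suc K) * measure (P \<mu>) many \<le> real (Suc K) * (1/10)"
      by (rule order_trans)
    then show ?thesis by (simp only: mult_le_cancel_left_pos of_nat_0_less_iff zero_less_Suc)
  qed
  \<comment> \<open>Fixing the number of pulls makes the piece depend on the first \<open>j\<close>
    samples of \<open>a\<close> only, as the change of measure requires.\<close>
  define F where "F j = {p \<in> returns_by t \<O>. pulls_before a t p = j}" for j
  have F_m [measurable]: "F j \<in> sets table" for j
  proof -
    have "F j = returns_by t \<O> \<inter> {p \<in> space table. pulls_before a t p = j}"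
      by (auto simp: F_def returns_by_def)
    also have "\<dots> \<in> sets table" by measurable
    finally show ?thesis .
  qed
  have disj: "disjoint_family_on F {..K}"
    by (auto simp: disjoint_family_on_def F_def)
  have F_sum: "measure (P \<nu>) (\<Union>j\<le>K. F j) = (\<Sum>j\<le>K. measure (P \<nu>) (F j))" for \<nu>
    using disj by (intro P.finite_measure_finite_Union) auto
  have "measure (P \<mu>) (returns_by t \<O>) \<le> measure (P \<mu>) ((\<Union>j\<le>K. F j) \<union> many)"
  proof (rule P.finite_measure_mono)
    show "returns_by t \<O> \<subseteq> (\<Union>j\<le>K. F j) \<union> many"
      by (auto simp: F_def many_def returns_by_def not_less)
  qed auto
  also have "\<dots> \<le> measure (P \<mu>) (\<Union>j\<le>K. F j) + measure (P \<mu>) many"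
    by (intro measure_Un_le) auto
  finally have big: "4/5 \<le> measure (P \<mu>) (\<Union>j\<le>K. F j)"
    using t many_le by simp
  let ?p = "\<mu>(a := \<mu> a + \<Delta>)" and ?m = "\<mu>(a := \<mu> a - \<Delta>)"
  have sa: "0 < s a" using a s_pos by simp
  \<comment> \<open>A common bound for the factors of all pieces, since
    \<open>j \<le> K \<le> 10 * B\<close>; it allows the pieces to be summed.\<close>
  define C where "C = exp (10 * B * (\<Delta>\<^sup>2 / s a) / 2)"
  have Cpos: "0 < C" by (simp add: C_def)
  have piece: "2 * measure (P \<mu>) (F j) \<le> C * (r * measure (P ?p) (F j) + 1 / r * measure (P ?m) (F j))"
    if "j \<le> K" "0 < r" for j r
  proof -
    have "2 * emeasure (P \<mu>) (F j) \<le> ennreal (exp (real j * (\<Delta>\<^sup>2 / s a) / 2)) *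
      (ennreal r * emeasure (P ?p) (F j) + ennreal (1 / r) * emeasure (P ?m) (F j))"
    proof (rule emeasure_P_change_of_measure[OF a F_m \<open>0 < r\<close>])
      have imp: "(\<omega>, X(a := Y')) \<in> F j"
        if eq: "\<And>k. k < j \<Longrightarrow> Y k = Y' k" and mem: "(\<omega>, X(a := Y)) \<in> F j" for \<omega> X Y Y'
      proof -
        have "length (filter (\<lambda>p. fst p = a) (hist alg \<omega> (X(a := Y)) t)) = j"
          using mem by (simp add: F_def pulls_before_def)
        then have h: "hist alg \<omega> (X(a := Y)) t = hist alg \<omega> (X(a := Y')) t"
          using eq by (intro hist_cong[of a]) auto
        have "(\<omega>, X(a := Y')) \<in> space table"
          using mem a
          by (auto simp: F_def returns_by_def space_pair_measure space_PiM PiE_def extensional_def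
             Pi_def split: if_splits)
        with mem h show ?thesis
          by (simp add: F_def returns_by_def pulls_before_def)
      qed
      show "(\<omega>, X(a := Y)) \<in> F j \<longleftrightarrow> (\<omega>, X(a := Y')) \<in> F j"
        if "\<And>k. k < j \<Longrightarrow> Y k = Y' k" for \<omega> X Y Y'
        using imp[of Y Y' \<omega> X] imp[of Y' Y \<omega> X] that by auto
    qed
    moreover have "ennreal (c * (b * x + d * y)) = ennreal c * (ennreal b * ennreal x + ennreal d * ennreal y)"
      if "0 \<le> c" "0 \<le> b" "0 \<le> d" "0 \<le> x" "0 \<le> y" for b c d x y
      using that by (simp add: ennreal_mult' ennreal_plus)
    ultimately have "ennreal (2 * measure (P \<mu>) (F j)) \<le> ennreal (exp (real j * (\<Delta>\<^sup>2 / s a) / 2) *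
      (r * measure (P ?p) (F j) + 1 / r * measure (P ?m) (F j)))"
      using \<open>0 < r\<close> by (simp only: P.emeasure_eq_measure ennreal_mult' ennreal_numeral
        exp_ge_zero measure_nonneg less_imp_le zero_le_divide_1_iff zero_le_numeral)
    then have "2 * measure (P \<mu>) (F j) \<le> exp (real j * (\<Delta>\<^sup>2 / s a) / 2) *
      (r * measure (P ?p) (F j) + 1 / r * measure (P ?m) (F j))"
      using \<open>0 < r\<close> by (subst (asm) ennreal_le_iff) auto
    also have "\<dots> \<le> C * (r * measure (P ?p) (F j) + 1 / r * measure (P ?m) (F j))"
    proof (intro mult_right_mono)
      have "real j * (\<Delta>\<^sup>2 / s a) \<le> 10 * B * (\<Delta>\<^sup>2 / s a)"
        using that K sa by (intro mult_right_mono) auto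
      then show "exp (real j * (\<Delta>\<^sup>2 / s a) / 2) \<le> C"
        unfolding C_def exp_le_cancel_iff by (rule divide_right_mono) simp
    qed (use \<open>0 < r\<close> in auto)
    finally show ?thesis .
  qed
  have whole: "2 * (4/5) \<le> C * (r * q + 1 / r)" if "0 < r" for r
  proof -
    have "2 * (4/5) \<le> 2 * measure (P \<mu>) (\<Union>j\<le>K. F j)"
      using big by simp
    also have "\<dots> \<le> (\<Sum>j\<le>K. C * (r * measure (P ?p) (F j) + 1 / r * measure (P ?m) (F j)))"
      unfolding F_sum sum_distrib_left by (intro sum_mono piece that) simp
    also have "\<dots> = C * (r * measure (P ?p) (\<Union>j\<le>K. F j) + 1 / r * measure (P ?m) (\<Union>j\<le>K. F j))"
      unfolding F_sum by (simp add: sum_distrib_left sum.distrib distrib_left)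
    also have "\<dots> \<le> C * (r * q + 1 / r * 1)"
    proof (intro mult_left_mono add_mono)
      have "measure (P ?p) (\<Union>j\<le>K. F j) \<le> measure (P ?p) (returns \<O>)"
        by (rule P.finite_measure_mono) (auto simp: F_def returns_def)
      with lo show "measure (P ?p) (\<Union>j\<le>K. F j) \<le> q" by simp
    qed (use that Cpos P.prob_le_1 in auto)
    finally show ?thesis by simp
  qed
  \<comment> \<open>For \<open>r = C / (4/5)\<close> the second term on the right is 4/5, half of
    the left side. The other half gives the claim with 16/25 as the square of 4/5.\<close>
  have "16/25 \<le> q * (C * C)"
    using whole[of "C / (4/5)"] Cpos by (simp add: field_simps)
  also have "C * C = exp (10 * B * (\<Delta>\<^sup>2 / s a))"
    by (simp add: C_def mult_exp_exp)
  finally show ?thesis .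
qed

end

section \<open>Lower bounds from families of instances\<close>

lemma kth_largest_cong:
  "(\<And>i. i < n \<Longrightarrow> f i = g i) \<Longrightarrow> kth_largest f {..<n} m = kth_largest g {..<n} m"
  unfolding kth_largest_def by (intro arg_cong[where f = "\<lambda>xs. rev (sort xs) ! (m - 1)"] map_cong) auto

text \<open>If the m-th largest value were below \<open>v\<close>, fewer than \<open>m\<close>
  entries would reach \<open>v\<close>, but \<open>A\<close> supplies \<open>m\<close> of them. Such
  lower bounds are what shows that an arm is not acceptable in the hard instances.\<close>

lemma kth_largest_ge:
  assumes A: "A \<subseteq> {..<n}" "m \<le> card A" "0 < m" and v: "\<And>i. i \<in> A \<Longrightarrow> v \<le> f i"
  shows "v \<le> kth_largest f {..<n} m"
proof (rule ccontr)
  assume neg: "\<not> v \<le> kth_largest f {..<n} m"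
  define ys where "ys = sort (map f (sorted_list_of_set {..<n}))"
  have len: "length ys = n"
    by (simp add: ys_def)
  have "card A \<le> n"
    using card_mono[OF finite_lessThan A(1)] by simp
  with A(2,3) have mn: "m \<le> n" "0 < m" by auto
  \<comment> \<open>In the ascending list the m-th largest entry has position \<open>n - m\<close>,
    so if it is below \<open>v\<close>, then so are the first \<open>n - m + 1\<close>
    entries.\<close>
  have "kth_largest f {..<n} m = ys ! (n - m)"
    using mn by (simp add: kth_largest_def ys_def[symmetric] rev_nth len Suc_diff_Suc)
  with neg have lt: "ys ! (n - m) < v" by simp
  have "filter (\<lambda>y. v \<le> y) (take (n - m + 1) ys) = []"
  proof -
    have "y < v" if y: "y \<in> set (take (n - m + 1) ys)" for y
    proof -
      obtain i where i: "i < n - m + 1" "i < n" "y = ys ! i"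
        using y by (auto simp: in_set_conv_nth len)
      have "ys ! i \<le> ys ! (n - m)"
        using i mn by (intro sorted_nth_mono) (auto simp: ys_def)
      with lt i show ?thesis by simp
    qed
    then show ?thesis by (auto simp: filter_empty_conv not_le)
  qed
  then have "filter (\<lambda>y. v \<le> y) ys = filter (\<lambda>y. v \<le> y) (drop (n - m + 1) ys)"
    by (metis append_take_drop_id filter_append append_Nil)
  also have "length \<dots> \<le> m - 1"
    using mn by (intro order_trans[OF length_filter_le]) (simp add: len)
  finally have "length (filter (\<lambda>y. v \<le> y) ys) \<le> m - 1" .
  moreover have "length (filter (\<lambda>y. v \<le> y) ys) = card {i \<in> {..<n}. v \<le> f i}"
  proof -
    have "size (filter_mset (\<lambda>y. v \<le> y) (mset ys)) = size (filter_mset (\<lambda>y. v \<le> y) (image_mset f (mset_set {..<n})))"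
      unfolding ys_def mset_sort mset_map
      using mset_set_set[of "sorted_list_of_set {..<n}"] by simp
    also have "\<dots> = card {i \<in> {..<n}. v \<le> f i}"
      by (simp add: filter_mset_image_mset)
    finally show ?thesis
      by (simp flip: mset_filter size_mset)
  qed
  moreover have "card A \<le> card {i \<in> {..<n}. v \<le> f i}"
    using A v by (intro card_mono) auto
  ultimately show False
    using A(2) mn by simp
qed

text \<open>Sums \<open>ln x \<le> x - 1\<close> at \<open>x = C * p a / c a\<close>. The weights
  \<open>c\<close> are not normalised, and the \<open>p a\<close> may sum to less than 1, which fits
  disjoint events that do not exhaust the space.\<close>

lemma gibbs_inequality:
  fixes c p :: "'a \<Rightarrow> real"
  assumes T: "finite T" and c: "\<And>a. a \<in> T \<Longrightarrow> 0 < c a" and p: "\<And>a. a \<in> T \<Longrightarrow> 0 < p a"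
    and p1: "(\<Sum>a\<in>T. p a) \<le> 1"
  shows "(\<Sum>a\<in>T. c a * ln ((\<Sum>b\<in>T. c b) / c a)) \<le> (\<Sum>a\<in>T. c a * ln (1 / p a))"
proof (cases "T = {}")
  case False
  define C where "C = (\<Sum>b\<in>T. c b)"
  have C: "0 < C"
    unfolding C_def using T False c by (intro sum_pos) auto
  have "(\<Sum>a\<in>T. c a * ln (C / c a)) - (\<Sum>a\<in>T. c a * ln (1 / p a)) \<le> (\<Sum>a\<in>T. C * p a - c a)"
    unfolding sum_subtractf[symmetric]
  proof (rule sum_mono)
    fix a assume a: "a \<in> T"
    have "c a * ln (C / c a) - c a * ln (1 / p a) = c a * ln (C * p a / c a)"
      using C c[OF a] p[OF a] by (simp add: ln_div ln_mult algebra_simps)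
    also have "\<dots> \<le> c a * (C * p a / c a - 1)"
      using C c[OF a] p[OF a] by (intro mult_left_mono ln_le_minus_one) auto
    also have "\<dots> = C * p a - c a"
      using c[OF a] by (simp add: field_simps)
    finally show "c a * ln (C / c a) - c a * ln (1 / p a) \<le> C * p a - c a" .
  qed
  also have "\<dots> = C * (\<Sum>a\<in>T. p a) - C"
    by (simp add: sum_subtractf sum_distrib_left C_def)
  also have "\<dots> \<le> 0"
    using C p1 mult_left_mono[OF p1, of C] by simp
  finally show ?thesis by (simp add: C_def)
qed simp

definition subsets_of_card :: "'a set \<Rightarrow> nat \<Rightarrow> 'a set set" where
  "subsets_of_card A k = {T. T \<subseteq> A \<and> card T = k}"

lemma finite_subsets_of_card: "finite A \<Longrightarrow> finite (subsets_of_card A k)"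
  unfolding subsets_of_card_def by (rule finite_subset[of _ "Pow A"]) auto

text \<open>Double counting: a set \<open>S\<close> with a new element \<open>a\<close> is the same
  as a set \<open>T = insert a S\<close> with a marked element \<open>a\<close>. It exchanges a sum
  over instances for a sum over enlarged sets of good arms.\<close>

lemma sum_subsets_of_card_Suc:
  assumes A: "finite A"
  shows "(\<Sum>S\<in>subsets_of_card A k. \<Sum>a\<in>A - S. g S a) =
    (\<Sum>T\<in>subsets_of_card A (Suc k). \<Sum>a\<in>T. g (T - {a}) a)"
proof -
  have fin: "finite T" if "T \<in> subsets_of_card A l" for T l
    using that A by (auto simp: subsets_of_card_def intro: finite_subset)
  have "(\<Sum>S\<in>subsets_of_card A k. \<Sum>a\<in>A - S. g S a) =
    (\<Sum>(S, a)\<in>Sigma (subsets_of_card A k) (\<lambda>S. A - S). g S a)"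
    using A by (intro sum.Sigma finite_subsets_of_card) auto
  also have "\<dots> = (\<Sum>(T, a)\<in>Sigma (subsets_of_card A (Suc k)) (\<lambda>T. T). g (T - {a}) a)"
  proof (rule sum.reindex_bij_witness[of _ "\<lambda>(T, a). (T - {a}, a)" "\<lambda>(S, a). (insert a S, a)"])
    fix x assume x: "x \<in> Sigma (subsets_of_card A k) (\<lambda>S. A - S)"
    obtain S a where [simp]: "x = (S, a)" by (cases x)
    have *: "S \<subseteq> A" "card S = k" "a \<in> A" "a \<notin> S" "finite S"
      using x fin[of S k] by (auto simp: subsets_of_card_def)
    then show "(case case x of (S, a) \<Rightarrow> (insert a S, a) of (T, a) \<Rightarrow> (T - {a}, a)) = x"
      "(case x of (S, a) \<Rightarrow> (insert a S, a)) \<in> Sigma (subsets_of_card A (Suc k)) (\<lambda>T. T)"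
      "(case case x of (S, a) \<Rightarrow> (insert a S, a) of (T, a) \<Rightarrow> g (T - {a}) a) = (case x of (S, a) \<Rightarrow> g S a)"
      by (auto simp: subsets_of_card_def insert_Diff_if)
  next
    fix x assume x: "x \<in> Sigma (subsets_of_card A (Suc k)) (\<lambda>T. T)"
    obtain T a where [simp]: "x = (T, a)" by (cases x)
    have *: "T \<subseteq> A" "card T = Suc k" "a \<in> T" "finite T"
      using x fin[of T "Suc k"] by (auto simp: subsets_of_card_def)
    then show "(case case x of (T, a) \<Rightarrow> (T - {a}, a) of (S, a) \<Rightarrow> (insert a S, a)) = x"
      "(case x of (T, a) \<Rightarrow> (T - {a}, a)) \<in> Sigma (subsets_of_card A k) (\<lambda>S. A - S)"
      by (auto simp: subsets_of_card_def insert_absorb)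
  qed
  also have "\<dots> = (\<Sum>T\<in>subsets_of_card A (Suc k). \<Sum>a\<in>T. g (T - {a}) a)"
    using A fin by (intro sum.Sigma[symmetric] finite_subsets_of_card) auto
  finally show ?thesis .
qed

section \<open>Disjoint outputs and summation over arms\<close>

context bandit
begin

lemma returns_disjoint:
  assumes "\<O> \<inter> \<O>' = {}"
  shows "returns \<O> \<inter> returns \<O>' = {}"
proof -
  have "alg_output alg (fst p) (snd p) \<in> \<O>" if p: "p \<in> returns \<O>" for p \<O>
  proof -
    obtain t S where "alg (fst p) (hist alg (fst p) (snd p) t) = Stop S" "S \<in> \<O>"
      using p by (auto simp: returns_def returns_by_def)
    then show ?thesis by (simp add: alg_output_eq)
  qed
  with assms show ?thesis by fastforce
qed

lemma sum_returns_le_1: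
  assumes "finite T" "\<And>a b. a \<in> T \<Longrightarrow> b \<in> T \<Longrightarrow> a \<noteq> b \<Longrightarrow> \<O> a \<inter> \<O> b = {}"
  shows "(\<Sum>a\<in>T. measure (P \<mu>) (returns (\<O> a))) \<le> 1"
proof -
  have "(\<Sum>a\<in>T. measure (P \<mu>) (returns (\<O> a))) = measure (P \<mu>) (\<Union>a\<in>T. returns (\<O> a))"
    using assms returns_disjoint
    by (intro P.finite_measure_finite_Union[symmetric]) (auto simp: disjoint_family_on_def)
  then show ?thesis by simp
qed

text \<open>Each \<open>L a\<close> is compared with every real \<open>B\<close> above the expected
  pulls of \<open>a\<close>, which keeps extended reals out of the applications. If the sum of the
  expected pulls is infinite, nothing is to be shown.\<close>

lemma expected_samples_ge_sum:
  assumes A: "A \<subseteq> {..<n}"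
    and L: "\<And>a B. a \<in> A \<Longrightarrow> 0 \<le> B \<Longrightarrow> (\<integral>\<^sup>+p. pulls a p \<partial>P \<mu>) \<le> ennreal B \<Longrightarrow> L a \<le> B"
  shows "ennreal (\<Sum>a\<in>A. L a) \<le> expected_samples n R (gauss_inst n s \<mu>) alg"
proof -
  define I where "I a = (\<integral>\<^sup>+p. pulls a p \<partial>P \<mu>)" for a
  have fin: "finite A"
    using A finite_subset by blast
  have "ennreal (\<Sum>a\<in>A. L a) \<le> (\<Sum>a\<in>A. I a)"
  proof (cases "(\<Sum>a\<in>A. I a) = \<infinity>")
    case False
    then have "I a \<noteq> \<top>" if "a \<in> A" for a
      using that fin by (auto simp: ennreal_sum_eq_top)
    then have I: "I a = ennreal (enn2real (I a))" if "a \<in> A" for a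
      using that by (simp add: less_top)
    have "L a \<le> enn2real (I a)" if "a \<in> A" for a
      using I[OF that] by (intro L[OF that]) (auto simp: I_def)
    then have "(\<Sum>a\<in>A. L a) \<le> (\<Sum>a\<in>A. enn2real (I a))"
      by (rule sum_mono)
    then have "ennreal (\<Sum>a\<in>A. L a) \<le> (\<Sum>a\<in>A. ennreal (enn2real (I a)))"
      by (simp add: ennreal_leI sum_ennreal)
    also have "\<dots> = (\<Sum>a\<in>A. I a)"
      using I by (intro sum.cong) auto
    finally show ?thesis .
  qed simp
  also have "\<dots> \<le> (\<Sum>a<n. I a)"
    using A by (intro sum_mono2) auto
  also have "\<dots> \<le> expected_samples n R (gauss_inst n s \<mu>) alg"
    unfolding I_def by (rule sum_pulls_le_expected_samples)
  finally show ?thesis .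
qed

end

section \<open>Hard instances for a correct algorithm\<close>

locale top_m_solver = bandit +
  fixes m :: nat and \<epsilon> \<delta> :: real
  assumes m: "0 < m" "2 * m < n" and \<epsilon>: "0 < \<epsilon>" and \<delta>: "0 < \<delta>" "\<delta> < 1/10"
    and solves: "solves n m s \<epsilon> \<delta> R alg"
begin

text \<open>Reduces the probabilistic guarantee to a deterministic check of which sets of arms are
  acceptable for the means \<open>\<mu>\<close>.\<close>

lemma returns_ge:
  assumes "\<And>S. S \<subseteq> {..<n} \<Longrightarrow> card S = m \<Longrightarrow> (\<And>i. i \<in> S \<Longrightarrow> kth_largest \<mu> {..<n} m - \<epsilon> \<le> \<mu> i) \<Longrightarrow> S \<in> \<O>"
  shows "1 - \<delta> \<le> measure (P \<mu>) (returns \<O>)"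
proof -
  let ?\<nu> = "gauss_inst n s \<mu>"
  have mean: "arm_mean ?\<nu> i = \<mu> i" if "i < n" for i
    using that s_pos by (simp add: arm_mean_gauss_inst)
  have kth: "kth_largest (arm_mean ?\<nu>) {..<n} m = kth_largest \<mu> {..<n} m"
    by (intro kth_largest_cong mean)
  have "1 - \<delta> \<le> measure (P \<mu>)
          {p \<in> space (P \<mu>).
             (\<exists>t. stopped alg (fst p) (snd p) t) \<and>
             alg_output alg (fst p) (snd p) \<subseteq> {..<n} \<and>
             card (alg_output alg (fst p) (snd p)) = m \<and>
             (\<forall>i\<in>alg_output alg (fst p) (snd p). eps_top n m (arm_mean ?\<nu>) \<epsilon> i)}"
    using solves bandit_instance_gauss_inst[of n s \<mu>] s_pos unfolding solves_def P_def by blast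
  also have "\<dots> \<le> measure (P \<mu>) (returns \<O>)"
  proof (intro P.finite_measure_mono subsetI; (simp only: sets_P returns_measurable)?)
    fix p assume "p \<in> {p \<in> space (P \<mu>).
             (\<exists>t. stopped alg (fst p) (snd p) t) \<and>
             alg_output alg (fst p) (snd p) \<subseteq> {..<n} \<and>
             card (alg_output alg (fst p) (snd p)) = m \<and>
             (\<forall>i\<in>alg_output alg (fst p) (snd p). eps_top n m (arm_mean ?\<nu>) \<epsilon> i)}"
    then obtain t S where p: "p \<in> space table" and S: "alg (fst p) (hist alg (fst p) (snd p) t) = Stop S"
      "S \<subseteq> {..<n}" "card S = m" and top: "\<forall>i\<in>S. eps_top n m (arm_mean ?\<nu>) \<epsilon> i"
      by (auto simp: stopped_def alg_output_eq)
    have "kth_largest \<mu> {..<n} m - \<epsilon> \<le> \<mu> i" if "i \<in> S" for i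
      using top mean[OF subsetD[OF S(2) that, simplified]] that by (auto simp: eps_top_def kth)
    with S have "S \<in> \<O>"
      by (intro assms)
    with p S(1) show "p \<in> returns \<O>"
      by (auto simp: returns_def returns_by_def)
  qed
  finally show ?thesis .
qed

text \<open>This is \<open>transportation\<close> solved for \<open>B\<close>. The shift enters
  through an upper bound \<open>d\<close>, so that shifts of different sizes share one bound.
  Positivity of \<open>q\<close> is a separate conclusion because the logarithm is informative only
  then.\<close>

lemma pulls_lower_bound:
  assumes a: "a < n" and B: "0 \<le> B" "(\<integral>\<^sup>+p. pulls a p \<partial>P \<mu>) \<le> ennreal B"
    and hi: "9/10 < measure (P \<mu>) (returns \<O>)"
    and q: "measure (P (\<mu>(a := \<mu> a + \<Delta>))) (returns \<O>) \<le> q"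
    and \<Delta>: "\<bar>\<Delta>\<bar> \<le> d" "0 < d"
  shows "0 < q" and "s a / (10 * d\<^sup>2) * ln (16 / 25 / q) \<le> B"
proof -
  have sa: "0 < s a" using a s_pos by simp
  have 1: "16/25 \<le> q * exp (10 * B * (\<Delta>\<^sup>2 / s a))"
    by (rule transportation[OF a B hi q])
  then have "0 < q * exp (10 * B * (\<Delta>\<^sup>2 / s a))" by simp
  then show q0: "0 < q" by (simp add: zero_less_mult_iff)
  have "\<Delta>\<^sup>2 \<le> d\<^sup>2"
    using \<Delta> by (simp add: abs_le_square_iff[symmetric])
  then have "10 * B * (\<Delta>\<^sup>2 / s a) \<le> 10 * B * (d\<^sup>2 / s a)"
    using B(1) sa by (intro mult_left_mono divide_right_mono) auto
  then have "q * exp (10 * B * (\<Delta>\<^sup>2 / s a)) \<le> q * exp (10 * B * (d\<^sup>2 / s a))"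
    using q0 by simp
  with 1 have "16/25 \<le> q * exp (10 * B * (d\<^sup>2 / s a))"
    by (rule order_trans)
  then have "16/25/q \<le> exp (10 * B * (d\<^sup>2 / s a))"
    using q0 by (simp add: field_simps)
  then have "ln (16/25/q) \<le> 10 * B * (d\<^sup>2 / s a)"
    using q0 ln_mono[of "16/25/q" "exp (10 * B * (d\<^sup>2 / s a))"] by simp
  then have "s a / (10 * d\<^sup>2) * ln (16/25/q) \<le> s a / (10 * d\<^sup>2) * (10 * B * (d\<^sup>2 / s a))"
    using sa by (intro mult_left_mono) auto
  also have "\<dots> = B" using sa \<Delta> by (simp add: field_simps)
  finally show "s a / (10 * d\<^sup>2) * ln (16 / 25 / q) \<le> B" .
qed

text \<open>The arms below m must be returned, but raising any other arm pushes arm 0 out, and lowering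
  any arm below m makes it unacceptable.\<close>

lemma confidence_lower_bound:
  "ennreal (\<Sum>a<n. s a / (360 * \<epsilon>\<^sup>2) * ln (16 / 25 / \<delta>)) \<le> expected_samples n R
    (gauss_inst n s (\<lambda>i. if i = 0 then 2 * \<epsilon> else if i < m then 4 * \<epsilon> else 0)) alg"
    (is "_ \<le> expected_samples n R (gauss_inst n s ?\<mu>) alg")
proof (rule expected_samples_ge_sum)
  fix a B assume a: "a \<in> {..<n}" and B: "0 \<le> B" "(\<integral>\<^sup>+p. pulls a p \<partial>P ?\<mu>) \<le> ennreal B"
  have "1 - \<delta> \<le> measure (P ?\<mu>) (returns {{..<m}})"
  proof (rule returns_ge)
    fix S assume S: "S \<subseteq> {..<n}" "card S = m"
      and top: "\<And>i. i \<in> S \<Longrightarrow> kth_largest ?\<mu> {..<n} m - \<epsilon> \<le> ?\<mu> i"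
    have "2 * \<epsilon> \<le> kth_largest ?\<mu> {..<n} m"
      using m \<epsilon> by (intro kth_largest_ge[of "{..<m}"]) auto
    then have "\<epsilon> \<le> ?\<mu> i" if "i \<in> S" for i
      using top[OF that] by linarith
    then have "i < m" if "i \<in> S" for i
      using that m \<epsilon> by (fastforce split: if_splits)
    then have "S \<subseteq> {..<m}" by auto
    with S show "S \<in> {{..<m}}"
      using card_subset_eq[of "{..<m}" S] by simp
  qed
  then have hi: "9/10 < measure (P ?\<mu>) (returns {{..<m}})"
    using \<delta> by simp
  \<comment> \<open>An arm below \<open>m\<close> falls to \<open>- 2 * \<epsilon>\<close>, while
    the other arms keep the m-th largest mean at least 0. Any other arm rises to
    \<open>4 * \<epsilon>\<close> and together with the arms 1 to m - 1 excludes arm 0, whose mean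
    is \<open>2 * \<epsilon>\<close>.\<close>
  define \<Delta> where "\<Delta> = (if a < m then - 2 * \<epsilon> - ?\<mu> a else 4 * \<epsilon>)"
  let ?\<mu>' = "?\<mu>(a := ?\<mu> a + \<Delta>)"
  have "1 - \<delta> \<le> measure (P ?\<mu>') (returns (- {{..<m}}))"
  proof (rule returns_ge, rule ComplI, unfold singleton_iff)
    fix S assume top: "\<And>i. i \<in> S \<Longrightarrow> kth_largest ?\<mu>' {..<n} m - \<epsilon> \<le> ?\<mu>' i" and S: "S = {..<m}"
    show False
    proof (cases "a < m")
      case True
      have "0 \<le> kth_largest ?\<mu>' {..<n} m"
        using m \<epsilon> a by (intro kth_largest_ge[of "{..<n} - {a}"]) auto
      with top[of a] S True \<epsilon> show False
        by (simp add: \<Delta>_def)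
    next
      case False
      have "4 * \<epsilon> \<le> kth_largest ?\<mu>' {..<n} m"
        using m \<epsilon> a False by (intro kth_largest_ge[of "insert a {1..<m}"]) (auto simp: \<Delta>_def)
      with top[of 0] S m False \<epsilon> show False
        by simp
    qed
  qed
  moreover have "measure (P ?\<mu>') (returns {{..<m}}) + measure (P ?\<mu>') (returns (- {{..<m}})) \<le> 1"
    using sum_returns_le_1[of "{True, False}" "\<lambda>b. if b then {{..<m}} else - {{..<m}}" ?\<mu>']
    by simp
  ultimately have lo: "measure (P ?\<mu>') (returns {{..<m}}) \<le> \<delta>"
    by simp
  \<comment> \<open>The largest shift leads from \<open>4 * \<epsilon>\<close> to
    \<open>- 2 * \<epsilon>\<close>; then \<open>10 * (6 * \<epsilon>)\<^sup>2\<close> is the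
    denominator \<open>360 * \<epsilon>\<^sup>2\<close>.\<close>
  have "\<bar>\<Delta>\<bar> \<le> 6 * \<epsilon>"
    using \<epsilon> by (auto simp: \<Delta>_def)
  from pulls_lower_bound(2)[OF _ B hi lo this] a \<epsilon>
  show "s a / (360 * \<epsilon>\<^sup>2) * ln (16 / 25 / \<delta>) \<le> B"
    by (simp add: power_mult_distrib)
qed simp

definition good :: "nat set \<Rightarrow> nat \<Rightarrow> real" where
  "good S i = (if i \<in> S then 4 * \<epsilon> else 0)"

text \<open>The q_T(a) of the opening comment, used for sets \<open>T\<close> of
  \<open>m + 1\<close> good arms.\<close>

definition omit_prob :: "nat set \<Rightarrow> nat \<Rightarrow> real" where
  "omit_prob T a = measure (P (good T)) (returns {T - {a}})"

lemma sum_omit_prob_le_1: "finite T \<Longrightarrow> (\<Sum>a\<in>T. omit_prob T a) \<le> 1"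
  unfolding omit_prob_def by (rule sum_returns_le_1) auto

text \<open>Under \<open>good S\<close> an acceptable arm has mean at least
  \<open>3 * \<epsilon>\<close>, so \<open>S\<close> is the only correct answer. Raising an arm
  \<open>a\<close> outside \<open>S\<close> by \<open>4 * \<epsilon>\<close> yields
  \<open>good (insert a S)\<close>, where \<open>S\<close> is the answer that omits
  \<open>a\<close>. The denominator is \<open>10 * (4 * \<epsilon>)\<^sup>2\<close>, and finiteness
  of the expectation supplies the \<open>B\<close> from which positivity follows.\<close>

lemma good_lower_bound:
  assumes S: "S \<subseteq> {..<n}" "card S = m"
    and fin: "expected_samples n R (gauss_inst n s (good S)) alg \<noteq> \<infinity>"
  shows "\<And>a. a < n \<Longrightarrow> a \<notin> S \<Longrightarrow> 0 < omit_prob (insert a S) a"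
    and "A \<subseteq> {..<n} - S \<Longrightarrow> ennreal (\<Sum>a\<in>A. s a / (160 * \<epsilon>\<^sup>2) * ln (16 / 25 / omit_prob (insert a S) a))
      \<le> expected_samples n R (gauss_inst n s (good S)) alg"
proof -
  have "1 - \<delta> \<le> measure (P (good S)) (returns {S})"
  proof (rule returns_ge)
    fix S' assume S': "S' \<subseteq> {..<n}" "card S' = m"
      and top: "\<And>i. i \<in> S' \<Longrightarrow> kth_largest (good S) {..<n} m - \<epsilon> \<le> good S i"
    have "4 * \<epsilon> \<le> kth_largest (good S) {..<n} m"
      using m \<epsilon> S by (intro kth_largest_ge[of S]) (auto simp: good_def)
    then have g: "3 * \<epsilon> \<le> good S i" if "i \<in> S'" for i
      using top[OF that] by linarith
    have "i \<in> S" if "i \<in> S'" for i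
      using g[OF that] \<epsilon> by (simp add: good_def split: if_splits)
    then have "S' \<subseteq> S" by auto
    with S S' show "S' \<in> {S}"
      using card_subset_eq[of S S'] finite_subset[OF S(1)] by simp
  qed
  then have hi: "9/10 < measure (P (good S)) (returns {S})"
    using \<delta> by simp
  have lo: "measure (P ((good S)(a := good S a + 4 * \<epsilon>))) (returns {S}) \<le> omit_prob (insert a S) a"
    if "a \<notin> S" for a
  proof -
    have "(good S)(a := good S a + 4 * \<epsilon>) = good (insert a S)" "insert a S - {a} = S"
      using that by (auto simp: good_def)
    then show ?thesis by (simp add: omit_prob_def)
  qed
  have 4: "\<bar>4 * \<epsilon>\<bar> \<le> 4 * \<epsilon>" "0 < 4 * \<epsilon>"
    using \<epsilon> by auto
  note lb = pulls_lower_bound[OF _ _ _ hi lo 4]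
  show "0 < omit_prob (insert a S) a" if a: "a < n" "a \<notin> S" for a
  proof -
    have "(\<integral>\<^sup>+p. pulls a p \<partial>P (good S)) \<le> (\<Sum>a<n. \<integral>\<^sup>+p. pulls a p \<partial>P (good S))"
      using a by (intro member_le_sum) auto
    also note sum_pulls_le_expected_samples
    finally have "(\<integral>\<^sup>+p. pulls a p \<partial>P (good S)) \<noteq> \<top>"
      using fin by (auto simp: top_unique)
    then obtain B where "0 \<le> B" "(\<integral>\<^sup>+p. pulls a p \<partial>P (good S)) = ennreal B"
      by (metis ennreal_cases)
    then show ?thesis
      using a by (intro lb(1)[of a B]) auto
  qed
  show "ennreal (\<Sum>a\<in>A. s a / (160 * \<epsilon>\<^sup>2) * ln (16 / 25 / omit_prob (insert a S) a))
      \<le> expected_samples n R (gauss_inst n s (good S)) alg" if A: "A \<subseteq> {..<n} - S"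
  proof (rule expected_samples_ge_sum)
    fix a B assume "a \<in> A" "0 \<le> B" "(\<integral>\<^sup>+p. pulls a p \<partial>P (good S)) \<le> ennreal B"
    with A show "s a / (160 * \<epsilon>\<^sup>2) * ln (16 / 25 / omit_prob (insert a S) a) \<le> B"
      using lb(2)[of a B] by (auto simp: power_mult_distrib)
  qed (use A in auto)
qed

text \<open>Averaging over the instances with weights w, the weights of the alternatives of T
  form the distribution to which Gibbs' inequality is applied.\<close>

lemma family_lower_bound:
  assumes H: "H \<subseteq> {..<n}" "m \<le> card H" and w: "\<And>S. S \<in> subsets_of_card H m \<Longrightarrow> 0 < w S"
  defines "c \<equiv> \<lambda>T a. w (T - {a}) * s a"
  shows "\<exists>S. ennreal (1 / (160 * \<epsilon>\<^sup>2) *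
      ((\<Sum>T\<in>subsets_of_card H (Suc m). \<Sum>a\<in>T. c T a * ln ((\<Sum>b\<in>T. c T b) / c T a)) /
         (\<Sum>S\<in>subsets_of_card H m. w S) + ln (16/25) * (\<Sum>a\<in>H. s a)))
    \<le> expected_samples n R (gauss_inst n s (good S)) alg"
proof (cases "\<exists>S. expected_samples n R (gauss_inst n s (good S)) alg = \<infinity>")
  case True
  then obtain S where "expected_samples n R (gauss_inst n s (good S)) alg = \<infinity>" ..
  then show ?thesis by (intro exI[of _ S]) simp
next
  \<comment> \<open>With all expectations finite, every \<open>omit_prob\<close> that occurs is
    positive, as Gibbs' inequality requires.\<close>
  case fin: False
  let ?N = "\<Sum>T\<in>subsets_of_card H (Suc m). \<Sum>a\<in>T. c T a * ln ((\<Sum>b\<in>T. c T b) / c T a)"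
  define W where "W = (\<Sum>S\<in>subsets_of_card H m. w S)"
  define e where "e S = (\<Sum>a\<in>H - S. s a * ln (1 / omit_prob (insert a S) a))" for S
  have finH: "finite H"
    using H finite_subset by blast
  obtain S0 where "S0 \<subseteq> H" "card S0 = m"
    using obtain_subset_with_card_n[OF H(2)] by blast
  then have ne: "S0 \<in> subsets_of_card H m"
    by (simp add: subsets_of_card_def)
  have W: "0 < W"
    unfolding W_def using ne w finH by (intro sum_pos finite_subsets_of_card) auto
  have pos: "0 < omit_prob T a" if T: "T \<in> subsets_of_card H (Suc m)" "a \<in> T" for T a
  proof -
    have "T - {a} \<subseteq> {..<n}" "card (T - {a}) = m" "a < n" "insert a (T - {a}) = T"
      using T H finite_subset[OF _ finH, of T] by (auto simp: subsets_of_card_def)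
    with good_lower_bound(1)[of "T - {a}" a] fin show ?thesis by auto
  qed
  have "?N \<le> (\<Sum>T\<in>subsets_of_card H (Suc m). \<Sum>a\<in>T. c T a * ln (1 / omit_prob T a))"
  proof (rule sum_mono)
    fix T assume T: "T \<in> subsets_of_card H (Suc m)"
    then have TH: "T \<subseteq> H" "finite T" "card T = Suc m"
      using finite_subset[OF _ finH] by (auto simp: subsets_of_card_def)
    show "(\<Sum>a\<in>T. c T a * ln ((\<Sum>b\<in>T. c T b) / c T a)) \<le> (\<Sum>a\<in>T. c T a * ln (1 / omit_prob T a))"
    proof (rule gibbs_inequality)
      fix a assume a: "a \<in> T"
      then have "T - {a} \<in> subsets_of_card H m" "a < n"
        using TH H by (auto simp: subsets_of_card_def)
      then show "0 < c T a"
        unfolding c_def using w s_pos by simp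
      show "0 < omit_prob T a" by (rule pos[OF T a])
    qed (use TH sum_omit_prob_le_1 in auto)
  qed
  also have "\<dots> = (\<Sum>S\<in>subsets_of_card H m. \<Sum>a\<in>H - S. w S * s a * ln (1 / omit_prob (insert a S) a))"
    unfolding sum_subsets_of_card_Suc[OF finH] c_def
    by (intro sum.cong refl) (simp add: insert_absorb)
  also have "\<dots> = (\<Sum>S\<in>subsets_of_card H m. w S * e S)"
    by (simp add: e_def sum_distrib_left mult.assoc)
  finally have N: "?N \<le> (\<Sum>S\<in>subsets_of_card H m. w S * e S)" .
  \<comment> \<open>The bound \<open>N\<close> concerns a weighted sum over the instances with total
    weight \<open>W\<close>, so some instance reaches the average.\<close>
  have "\<exists>S\<in>subsets_of_card H m. ?N / W \<le> e S"
  proof (rule ccontr)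
    assume "\<not> ?thesis"
    then have "(\<Sum>S\<in>subsets_of_card H m. w S * e S) < (\<Sum>S\<in>subsets_of_card H m. w S * (?N / W))"
      using ne w finH by (intro sum_strict_mono finite_subsets_of_card mult_strict_left_mono) (auto simp: not_le)
    also have "\<dots> = W * (?N / W)"
      unfolding W_def by (rule sum_distrib_right[symmetric])
    also have "\<dots> = ?N"
      using W by simp
    finally show False using N by simp
  qed
  then obtain S where S: "S \<subseteq> H" "card S = m" and eS: "?N / W \<le> e S"
    by (auto simp: subsets_of_card_def)
  have Sn: "S \<subseteq> {..<n}" using S H by auto
  have "1 / (160 * \<epsilon>\<^sup>2) * (?N / W + ln (16/25) * (\<Sum>a\<in>H. s a))
    \<le> 1 / (160 * \<epsilon>\<^sup>2) * (e S + ln (16/25) * (\<Sum>a\<in>H - S. s a))"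
  proof -
    have "(\<Sum>a\<in>H - S. s a) \<le> (\<Sum>a\<in>H. s a)"
      using finH H s_pos by (intro sum_mono2) (auto intro: less_imp_le)
    \<comment> \<open>The logarithm of 16/25 is negative, so passing from \<open>H - S\<close> to
      \<open>H\<close> weakens the bound and makes this term independent of
      \<open>S\<close>.\<close>
    then have "ln (16/25) * (\<Sum>a\<in>H. s a) \<le> ln (16/25) * (\<Sum>a\<in>H - S. s a)"
      by (rule mult_left_mono_neg) simp
    from add_mono[OF eS this] show ?thesis
      by (rule mult_left_mono) simp
  qed
  also have "\<dots> = (\<Sum>a\<in>H - S. s a / (160 * \<epsilon>\<^sup>2) * ln (16 / 25 / omit_prob (insert a S) a))"
    unfolding e_def sum_distrib_left sum.distrib[symmetric]
  proof (rule sum.cong[OF refl])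
    fix a assume a: "a \<in> H - S"
    then have "0 < omit_prob (insert a S) a"
      using S finite_subset[OF S(1) finH] by (intro pos) (auto simp: subsets_of_card_def)
    then have "ln (16 / 25 / omit_prob (insert a S) a) = ln (1 / omit_prob (insert a S) a) + ln (16/25)"
      by (subst ln_mult_pos[symmetric]) auto
    then show "1 / (160 * \<epsilon>\<^sup>2) * (s a * ln (1 / omit_prob (insert a S) a) + ln (16/25) * s a) =
      s a / (160 * \<epsilon>\<^sup>2) * ln (16 / 25 / omit_prob (insert a S) a)"
      by (simp only: ring_distribs) simp
  qed
  finally have "ennreal (1 / (160 * \<epsilon>\<^sup>2) * (?N / W + ln (16/25) * (\<Sum>a\<in>H. s a))) \<le>
    ennreal (\<Sum>a\<in>H - S. s a / (160 * \<epsilon>\<^sup>2) * ln (16 / 25 / omit_prob (insert a S) a))"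
    by (rule ennreal_leI)
  also have "\<dots> \<le> expected_samples n R (gauss_inst n s (good S)) alg"
    using H S fin Sn by (intro good_lower_bound(2)) auto
  finally show ?thesis
    unfolding W_def by blast
qed

end

section \<open>Two choices of weights\<close>

lemma card_subsets_of_card: "finite A \<Longrightarrow> card (subsets_of_card A k) = card A choose k"
  unfolding subsets_of_card_def by (rule n_subsets)

text \<open>For positive weights on a nonempty finite set this is \<open>Ent\<close> times the total
  weight. The scaled form is monotone in the set, unlike \<open>Ent\<close> itself.\<close>

definition weighted_entropy :: "('a \<Rightarrow> real) \<Rightarrow> 'a set \<Rightarrow> real" where
  "weighted_entropy s A = (\<Sum>a\<in>A. s a * ln ((\<Sum>b\<in>A. s b) / s a))"

lemma ln_sum_div_nonneg:
  fixes s :: "'a \<Rightarrow> real"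
  assumes "finite A" "a \<in> A" "\<And>b. b \<in> A \<Longrightarrow> 0 < s b"
  shows "0 \<le> ln ((\<Sum>b\<in>A. s b) / s a)"
proof -
  have "s a \<le> (\<Sum>b\<in>A. s b)"
    using assms by (intro member_le_sum) (auto intro: less_imp_le)
  then show ?thesis
    using assms(3)[OF assms(2)] by (intro ln_ge_zero) simp
qed

text \<open>Exchanging T with its complement in A, with a kept on both sides, shows that half of
  the sets T carry at least half of the total weight.\<close>

lemma sum_ln_balanced_subsets:
  fixes s :: "'a \<Rightarrow> real"
  assumes A: "finite A" "card A = 2 * m + 1" and s: "\<And>b. b \<in> A \<Longrightarrow> 0 < s b" and a: "a \<in> A"
  shows "real (2 * m choose m) * ln ((\<Sum>b\<in>A. s b) / (2 * s a))
    \<le> 2 * (\<Sum>T\<in>{T \<in> subsets_of_card A (Suc m). a \<in> T}. ln ((\<Sum>b\<in>T. s b) / s a))"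
proof -
  let ?F = "{T \<in> subsets_of_card A (Suc m). a \<in> T}"
  let ?Z = "\<lambda>T. \<Sum>b\<in>T. s b"
  \<comment> \<open>As \<open>A\<close> has \<open>2 * m + 1\<close> elements, the complement of
    \<open>T\<close> with \<open>a\<close> added again has \<open>m + 1\<close> elements, and
    \<open>co\<close> is an involution on \<open>?F\<close>.\<close>
  define co where "co T = insert a (A - T)" for T
  have F: "T \<subseteq> A \<and> finite T \<and> card T = Suc m \<and> a \<in> T" if "T \<in> ?F" for T
    using that A by (auto simp: subsets_of_card_def intro: finite_subset)
  have co_F: "co T \<in> ?F" if "T \<in> ?F" for T
  proof -
    note T = F[OF that]
    have "card (A - T) = m"
      using T A by (simp add: card_Diff_subset)
    then have "card (co T) = Suc m"
      using T A unfolding co_def by (subst card_insert_disjoint) auto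
    then show ?thesis
      using a by (auto simp: subsets_of_card_def co_def)
  qed
  have co_co: "co (co T) = T" if "T \<in> ?F" for T
    using F[OF that] by (auto simp: co_def)
  have swap: "(\<Sum>T\<in>?F. ln (?Z T / s a)) = (\<Sum>T\<in>?F. ln (?Z (co T) / s a))"
    by (rule sum.reindex_bij_witness[of _ co co]) (use co_F co_co in auto)
  \<comment> \<open>In units of \<open>s a\<close> the two sums are some x, y at least 1 whose sum
    is at least the total. From (x - 1) (y - 1) >= 0 follows x + y <= x y + 1 <= 2 x y.\<close>
  have pair: "ln (?Z A / (2 * s a)) \<le> ln (?Z T / s a) + ln (?Z (co T) / s a)" if T: "T \<in> ?F" for T
  proof -
    have sa: "0 < s a" using s a by simp
    have ge: "s a \<le> ?Z U" if "U \<in> ?F" for U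
      using F[OF that] s by (intro member_le_sum) (auto intro: less_imp_le)
    note 1 = ge[OF T] and 2 = ge[OF co_F[OF T]]
    have "?Z A = ?Z T + ?Z (A - T)"
      using F[OF T] A by (simp add: sum.subset_diff[of T A] add.commute)
    moreover have "?Z (co T) = s a + ?Z (A - T)"
      using F[OF T] A unfolding co_def by (subst sum.insert) auto
    ultimately have "?Z A \<le> ?Z T + ?Z (co T)"
      using sa by simp
    moreover have "(?Z T - s a) * (?Z (co T) - s a) \<ge> 0"
      using 1 2 by simp
    ultimately have "?Z A * s a \<le> 2 * (?Z T * ?Z (co T))"
    proof -
      have "?Z A * s a \<le> (?Z T + ?Z (co T)) * s a"
        using \<open>?Z A \<le> _\<close> sa by (intro mult_right_mono) auto
      also have "\<dots> \<le> ?Z T * ?Z (co T) + s a * s a"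
        using \<open>(?Z T - s a) * (?Z (co T) - s a) \<ge> 0\<close> by (simp add: algebra_simps)
      also have "s a * s a \<le> ?Z T * ?Z (co T)"
        using 1 2 sa by (intro mult_mono) auto
      finally show ?thesis by simp
    qed
    then have "?Z A / (2 * s a) \<le> (?Z T / s a) * (?Z (co T) / s a)"
      using sa by (simp add: field_simps)
    moreover have "0 < ?Z A"
      using A a s by (intro sum_pos) auto
    ultimately have "ln (?Z A / (2 * s a)) \<le> ln ((?Z T / s a) * (?Z (co T) / s a))"
      using sa by (intro ln_mono) auto
    also have "\<dots> = ln (?Z T / s a) + ln (?Z (co T) / s a)"
      using 1 2 sa by (intro ln_mult_pos) auto
    finally show ?thesis .
  qed
  have "card ?F = 2 * m choose m"
  proof -
    have "bij_betw (insert a) (subsets_of_card (A - {a}) m) ?F"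
    proof (rule bij_betw_byWitness[where f' = "\<lambda>T. T - {a}"])
      show "\<forall>S\<in>subsets_of_card (A - {a}) m. insert a S - {a} = S"
        by (auto simp: subsets_of_card_def)
      show "\<forall>T\<in>?F. insert a (T - {a}) = T"
        by auto
      show "insert a ` subsets_of_card (A - {a}) m \<subseteq> ?F"
      proof (intro image_subsetI)
        fix S assume S: "S \<in> subsets_of_card (A - {a}) m"
        then have "finite S" "a \<notin> S"
          using A by (auto simp: subsets_of_card_def intro: finite_subset)
        with S a show "insert a S \<in> ?F"
          by (auto simp: subsets_of_card_def)
      qed
      show "(\<lambda>T. T - {a}) ` ?F \<subseteq> subsets_of_card (A - {a}) m"
        using F by (auto simp: subsets_of_card_def)
    qed
    then have "card ?F = card (subsets_of_card (A - {a}) m)"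
      by (rule bij_betw_same_card[symmetric])
    then show ?thesis
      using A a by (simp add: card_subsets_of_card)
  qed
  then have "real (2 * m choose m) * ln (?Z A / (2 * s a)) = (\<Sum>T\<in>?F. ln (?Z A / (2 * s a)))"
    by simp
  also have "\<dots> \<le> (\<Sum>T\<in>?F. ln (?Z T / s a) + ln (?Z (co T) / s a))"
    by (intro sum_mono pair)
  also have "\<dots> = 2 * (\<Sum>T\<in>?F. ln (?Z T / s a))"
    unfolding sum.distrib swap[symmetric] by simp
  finally show ?thesis .
qed

text \<open>Compares the number of instances, the \<open>m\<close>-subsets of
  \<open>2 * m + 1\<close> arms, with the number of sets of \<open>m + 1\<close> arms through a
  given arm. Pascal's rule gives two binomials, neither above the central one.\<close>

lemma central_binomial_ge: "2 * m + 1 choose m \<le> 2 * (2 * m choose m)"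
proof (cases m)
  case (Suc k)
  have "2 * m + 1 choose m = (2 * m choose m) + (2 * m choose k)"
    using Suc by simp
  also have "2 * m choose k \<le> 2 * m choose m"
    by (rule binomial_maximum')
  finally show ?thesis by simp
qed simp

context top_m_solver
begin

text \<open>For product weights \<open>c T a\<close> is the product over \<open>T\<close> whatever
  \<open>a\<close> in \<open>T\<close> is, so each ratio under the logarithm is
  \<open>m + 1\<close>. Double counting turns the rest into an average over \<open>S\<close> of the
  variance outside \<open>S\<close>, which is at least \<open>\<tau>\<close>.\<close>

lemma product_weights_lower_bound:
  assumes \<tau>: "\<And>S. S \<in> subsets_of_card {..<n} m \<Longrightarrow> \<tau> \<le> (\<Sum>a\<in>{..<n} - S. s a)"
  shows "\<exists>S. ennreal (1 / (160 * \<epsilon>\<^sup>2) * (ln (real m + 1) * \<tau> + ln (16/25) * (\<Sum>a<n. s a)))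
    \<le> expected_samples n R (gauss_inst n s (good S)) alg"
proof -
  define w where "w S = (\<Prod>i\<in>S. s i)" for S
  define c where "c T a = w (T - {a}) * s a" for T a
  let ?N = "\<Sum>T\<in>subsets_of_card {..<n} (Suc m). \<Sum>a\<in>T. c T a * ln ((\<Sum>b\<in>T. c T b) / c T a)"
  let ?W = "\<Sum>S\<in>subsets_of_card {..<n} m. w S"
  have w: "0 < w S" if "S \<subseteq> {..<n}" for S
    unfolding w_def using that s_pos by (intro prod_pos) auto
  have ne: "{..<m} \<in> subsets_of_card {..<n} m"
    using m by (auto simp: subsets_of_card_def)
  have W: "0 < ?W"
  proof (rule sum_pos)
    show "subsets_of_card {..<n} m \<noteq> {}"
      using ne by blast
    show "0 < w S" if "S \<in> subsets_of_card {..<n} m" for S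
      using that by (intro w) (simp add: subsets_of_card_def)
  qed (simp add: finite_subsets_of_card)
  have c: "c T a = w T" if "T \<subseteq> {..<n}" "a \<in> T" for T a
    using that finite_subset[OF that(1)] unfolding c_def w_def
    by (simp add: prod.remove[of T a] mult.commute)
  have "?N = (\<Sum>T\<in>subsets_of_card {..<n} (Suc m). \<Sum>a\<in>T. ln (real m + 1) * (w (T - {a}) * s a))"
  proof (intro sum.cong refl)
    fix T a assume T: "T \<in> subsets_of_card {..<n} (Suc m)" and a: "a \<in> T"
    have T': "T \<subseteq> {..<n}" "card T = Suc m"
      using T by (auto simp: subsets_of_card_def)
    have "(\<Sum>b\<in>T. c T b) = (\<Sum>b\<in>T. w T)"
      using T' by (intro sum.cong refl c) auto
    then have "(\<Sum>b\<in>T. c T b) / c T a = real m + 1"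
      using c[OF T'(1) a] w[OF T'(1)] T'(2) by simp
    then show "c T a * ln ((\<Sum>b\<in>T. c T b) / c T a) = ln (real m + 1) * (w (T - {a}) * s a)"
      by (simp add: c_def)
  qed
  also have "\<dots> = ln (real m + 1) * (\<Sum>S\<in>subsets_of_card {..<n} m. \<Sum>a\<in>{..<n} - S. w S * s a)"
    by (simp add: sum_subsets_of_card_Suc sum_distrib_left)
  finally have N: "?N = ln (real m + 1) * (\<Sum>S\<in>subsets_of_card {..<n} m. \<Sum>a\<in>{..<n} - S. w S * s a)" .
  have "(\<Sum>S\<in>subsets_of_card {..<n} m. w S * \<tau>) \<le> (\<Sum>S\<in>subsets_of_card {..<n} m. \<Sum>a\<in>{..<n} - S. w S * s a)"
  proof (rule sum_mono)
    fix S assume S: "S \<in> subsets_of_card {..<n} m"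
    then have "w S * \<tau> \<le> w S * (\<Sum>a\<in>{..<n} - S. s a)"
      using w[of S] by (intro mult_left_mono \<tau>) (auto simp: subsets_of_card_def)
    then show "w S * \<tau> \<le> (\<Sum>a\<in>{..<n} - S. w S * s a)"
      by (simp add: sum_distrib_left)
  qed
  then have "ln (real m + 1) * (?W * \<tau>) \<le> ?N"
    unfolding N sum_distrib_right by (intro mult_left_mono) auto
  then have "ln (real m + 1) * \<tau> \<le> ?N / ?W"
    using W by (simp add: field_simps)
  then have "1 / (160 * \<epsilon>\<^sup>2) * (ln (real m + 1) * \<tau> + ln (16/25) * (\<Sum>a<n. s a)) \<le>
     1 / (160 * \<epsilon>\<^sup>2) * (?N / ?W + ln (16/25) * (\<Sum>a<n. s a))"
    by (intro mult_left_mono) auto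
  moreover have "\<exists>S. ennreal (1 / (160 * \<epsilon>\<^sup>2) * (?N / ?W + ln (16/25) * (\<Sum>a<n. s a)))
    \<le> expected_samples n R (gauss_inst n s (good S)) alg"
    unfolding c_def
    by (rule family_lower_bound) (use m w in \<open>auto simp: subsets_of_card_def\<close>)
  ultimately show ?thesis
    by (meson ennreal_leI order_trans)
qed

text \<open>Exchanging the sums leaves, for each arm \<open>a\<close>, the logarithms over the sets
  \<open>T\<close> through \<open>a\<close>, which \<open>sum_ln_balanced_subsets\<close> bounds.
  The 4 combines its factor 2 with that of \<open>central_binomial_ge\<close>, and
  \<open>ln 2\<close> comes from the denominator \<open>2 * s a\<close>.\<close>

lemma uniform_weights_lower_bound:
  assumes H: "H \<subseteq> {..<n}" "card H = 2 * m + 1"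
  shows "\<exists>S. ennreal (1 / (160 * \<epsilon>\<^sup>2) *
      ((weighted_entropy s H - ln 2 * (\<Sum>a\<in>H. s a)) / 4 + ln (16/25) * (\<Sum>a\<in>H. s a)))
    \<le> expected_samples n R (gauss_inst n s (good S)) alg"
proof -
  let ?Z = "\<lambda>T. \<Sum>b\<in>T. s b"
  let ?N = "\<Sum>T\<in>subsets_of_card H (Suc m). \<Sum>a\<in>T. s a * ln (?Z T / s a)"
  have finH: "finite H"
    using H(1) finite_subset by blast
  have pos: "0 < s a" if "a \<in> H" for a
    using that H s_pos by auto
  let ?W = "real (2 * m + 1 choose m)"
  have W: "0 < ?W" by (simp add: zero_less_binomial)
  have "?W * (s a * ln (?Z H / (2 * s a)) / 4) \<le>
    s a * (\<Sum>T\<in>{T \<in> subsets_of_card H (Suc m). a \<in> T}. ln (?Z T / s a))" (is "_ \<le> s a * ?L") if a: "a \<in> H" for a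
  proof -
    define x where "x = ln (?Z H / (2 * s a))"
    have L0: "0 \<le> ?L"
    proof (rule sum_nonneg)
      fix T assume "T \<in> {T \<in> subsets_of_card H (Suc m). a \<in> T}"
      then show "0 \<le> ln (?Z T / s a)"
        using finite_subset[OF _ finH] pos by (intro ln_sum_div_nonneg) (auto simp: subsets_of_card_def)
    qed
    have "?W * x \<le> 4 * ?L"
    proof (cases "0 \<le> x")
      case True
      have "?W * x \<le> real (2 * (2 * m choose m)) * x"
        using central_binomial_ge[of m] True by (intro mult_right_mono of_nat_mono) auto
      also have "\<dots> = 2 * (real (2 * m choose m) * x)" by simp
      also have "real (2 * m choose m) * x \<le> 2 * ?L"
        unfolding x_def using sum_ln_balanced_subsets[OF finH H(2) pos a] .
      finally show ?thesis by simp
    next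
      \<comment> \<open>Here \<open>a\<close> carries more than half of the variance of
        \<open>H\<close>, and the left side is negative.\<close>
      case False
      then have "?W * x \<le> 0"
        by (intro mult_nonneg_nonpos) auto
      with L0 show ?thesis by linarith
    qed
    then have "s a * (?W * x / 4) \<le> s a * ?L"
      using pos[OF a] by (intro mult_left_mono) auto
    then show ?thesis
      by (simp add: x_def algebra_simps)
  qed
  then have "(\<Sum>a\<in>H. ?W * (s a * ln (?Z H / (2 * s a)) / 4)) \<le>
    (\<Sum>a\<in>H. s a * (\<Sum>T\<in>{T \<in> subsets_of_card H (Suc m). a \<in> T}. ln (?Z T / s a)))"
    by (rule sum_mono)
  also have "\<dots> = (\<Sum>a\<in>H. \<Sum>T | T \<in> subsets_of_card H (Suc m) \<and> a \<in> T. s a * ln (?Z T / s a))"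
    by (simp add: sum_distrib_left)
  also have "\<dots> = (\<Sum>T\<in>subsets_of_card H (Suc m). \<Sum>a | a \<in> H \<and> a \<in> T. s a * ln (?Z T / s a))"
    using finH by (rule sum.swap_restrict) (rule finite_subsets_of_card[OF finH])
  also have "\<dots> = ?N"
    by (intro sum.cong refl) (auto simp: subsets_of_card_def)
  also have "(\<Sum>a\<in>H. ?W * (s a * ln (?Z H / (2 * s a)) / 4)) = ?W * ((weighted_entropy s H - ln 2 * ?Z H) / 4)"
  proof -
    have "ln (?Z H / (2 * s a)) = ln (?Z H / s a) - ln 2" if "a \<in> H" for a
    proof -
      have "0 < ?Z H"
        using that finH pos by (intro sum_pos) auto
      then have "ln ((?Z H / s a) / 2) = ln (?Z H / s a) - ln 2"
        using pos[OF that] by (subst ln_div) auto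
      then show ?thesis by (simp add: mult.commute)
    qed
    then have "(\<Sum>a\<in>H. s a * ln (?Z H / (2 * s a))) = weighted_entropy s H - ln 2 * ?Z H"
      by (simp add: weighted_entropy_def right_diff_distrib sum_subtractf sum_distrib_right mult.commute)
    then show ?thesis
      by (simp add: sum_distrib_left[symmetric] sum_divide_distrib[symmetric])
  qed
  finally have "(weighted_entropy s H - ln 2 * ?Z H) / 4 \<le> ?N / ?W"
    using W by (simp add: field_simps)
  then have "1 / (160 * \<epsilon>\<^sup>2) * ((weighted_entropy s H - ln 2 * ?Z H) / 4 + ln (16/25) * ?Z H) \<le>
     1 / (160 * \<epsilon>\<^sup>2) * (?N / ?W + ln (16/25) * ?Z H)"
    by (intro mult_left_mono) auto
  moreover have "\<exists>S. ennreal (1 / (160 * \<epsilon>\<^sup>2) * (?N / ?W + ln (16/25) * ?Z H))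
    \<le> expected_samples n R (gauss_inst n s (good S)) alg"
    using family_lower_bound[of H "\<lambda>_. 1"] H finH by (simp add: card_subsets_of_card)
  ultimately show ?thesis
    by (meson ennreal_leI order_trans)
qed

end

section \<open>Entropy and dyadic groups\<close>

lemma Ent_eq_weighted_entropy:
  assumes "finite A" "A \<noteq> {}" "\<And>a. a \<in> A \<Longrightarrow> 0 < s a"
  shows "(\<Sum>a\<in>A. s a) * Ent s A = weighted_entropy s A"
proof -
  define Z where "Z = (\<Sum>a\<in>A. s a)"
  have Z: "0 < Z"
    unfolding Z_def using assms by (intro sum_pos) auto
  have "Z * Ent s A = (\<Sum>a\<in>A. Z * - (s a / Z * ln (s a / Z)))"
    by (simp add: Ent_def Z_def[symmetric] Let_def sum_distrib_left sum_negf)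
  also have "\<dots> = (\<Sum>a\<in>A. s a * ln (Z / s a))"
    using Z assms(3) by (intro sum.cong refl) (simp add: ln_div field_simps)
  finally show ?thesis
    by (simp add: weighted_entropy_def Z_def)
qed

lemma weighted_entropy_nonneg:
  assumes "finite A" "\<And>a. a \<in> A \<Longrightarrow> 0 < s a"
  shows "0 \<le> weighted_entropy s A"
  unfolding weighted_entropy_def using assms
  by (intro sum_nonneg mult_nonneg_nonneg ln_sum_div_nonneg) (auto intro: less_imp_le)

text \<open>Enlarging the set raises the total inside each logarithm and adds only nonnegative
  terms.\<close>

lemma weighted_entropy_mono:
  assumes "finite B" "A \<subseteq> B" "\<And>a. a \<in> B \<Longrightarrow> 0 < s a"
  shows "weighted_entropy s A \<le> weighted_entropy s B"
proof -
  have finA: "finite A" using assms finite_subset by blast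
  have "weighted_entropy s A \<le> (\<Sum>a\<in>A. s a * ln ((\<Sum>b\<in>B. s b) / s a))"
    unfolding weighted_entropy_def
  proof (rule sum_mono)
    fix a assume a: "a \<in> A"
    have "0 < (\<Sum>b\<in>A. s b)"
      using a assms finA by (intro sum_pos) auto
    moreover have "(\<Sum>b\<in>A. s b) \<le> (\<Sum>b\<in>B. s b)"
      using assms by (intro sum_mono2) (auto intro: less_imp_le)
    moreover have "0 < s a"
      using a assms by auto
    ultimately show "s a * ln ((\<Sum>b\<in>A. s b) / s a) \<le> s a * ln ((\<Sum>b\<in>B. s b) / s a)"
      by (intro mult_left_mono ln_mono) (auto simp: divide_right_mono)
  qed
  also have "\<dots> \<le> weighted_entropy s B"
    unfolding weighted_entropy_def using assms
    by (intro sum_mono2 mult_nonneg_nonneg ln_sum_div_nonneg) (auto intro: less_imp_le)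
  finally show ?thesis .
qed

text \<open>Chain rule of entropy: the union contributes the two parts and the entropy of the split
  into two blocks, which is at most \<open>ln 2\<close> times the total.\<close>

lemma weighted_entropy_Un_le:
  assumes "finite A" "finite B" "A \<inter> B = {}" "\<And>a. a \<in> A \<union> B \<Longrightarrow> 0 < s a"
  shows "weighted_entropy s (A \<union> B) \<le> weighted_entropy s A + weighted_entropy s B + ln 2 * (\<Sum>a\<in>A \<union> B. s a)"
proof (cases "A = {} \<or> B = {}")
  case True
  moreover have "0 \<le> ln 2 * (\<Sum>a\<in>A \<union> B. s a)"
    using assms by (intro mult_nonneg_nonneg sum_nonneg) (auto intro: less_imp_le)
  ultimately show ?thesis
    by (auto simp: weighted_entropy_def)
next
  case False
  define x where "x = (\<Sum>a\<in>A. s a)"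
  define y where "y = (\<Sum>a\<in>B. s a)"
  have x: "0 < x" and y: "0 < y"
    unfolding x_def y_def using assms False by (auto intro!: sum_pos)
  have Z: "(\<Sum>a\<in>A \<union> B. s a) = x + y"
    using assms by (simp add: sum.union_disjoint x_def y_def)
  have part: "(\<Sum>a\<in>C. s a * ln ((x + y) / s a)) = weighted_entropy s C + z * ln ((x + y) / z)"
    if C: "z = (\<Sum>a\<in>C. s a)" "0 < z" "\<And>a. a \<in> C \<Longrightarrow> 0 < s a" for C z
  proof -
    have "(\<Sum>a\<in>C. s a * ln ((x + y) / s a)) = (\<Sum>a\<in>C. s a * ln (z / s a) + s a * ln ((x + y) / z))"
      using that x y by (intro sum.cong refl) (simp add: ln_div algebra_simps)
    then show ?thesis
      by (simp add: sum.distrib weighted_entropy_def sum_distrib_right C(1))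
  qed
  have "x * ln ((x + y) / x) + y * ln ((x + y) / y) \<le> ln 2 * (x + y)"
  proof -
    \<comment> \<open>This compares \<open>z\<close> with the mean of \<open>x\<close> and
      \<open>y\<close>; the right sides for \<open>z = x\<close> and \<open>z = y\<close>
      cancel.\<close>
    have "z * ln ((x + y) / (2 * z)) \<le> (x + y) / 2 - z" if "0 < z" for z
    proof -
      have "z * ln ((x + y) / (2 * z)) \<le> z * ((x + y) / (2 * z) - 1)"
        using that x y by (intro mult_left_mono ln_le_minus_one) auto
      also have "\<dots> = (x + y) / 2 - z"
        using that by (simp add: field_simps)
      finally show ?thesis .
    qed
    from this[OF x] this[OF y]
    have "x * ln ((x + y) / (2 * x)) + y * ln ((x + y) / (2 * y)) \<le> 0"
      by simp
    moreover have halve: "z * ln ((x + y) / (2 * z)) = z * ln ((x + y) / z) - ln 2 * z" if "0 < z" for z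
      using that x y by (simp add: ln_div ln_mult algebra_simps)
    ultimately show ?thesis
      unfolding halve[OF x] halve[OF y] by (simp add: distrib_left)
  qed
  moreover have "weighted_entropy s (A \<union> B) =
    (\<Sum>a\<in>A. s a * ln ((x + y) / s a)) + (\<Sum>a\<in>B. s a * ln ((x + y) / s a))"
    unfolding weighted_entropy_def Z using assms by (intro sum.union_disjoint) auto
  ultimately show ?thesis
    unfolding Z using part[OF x_def x] part[OF y_def y] assms(4) by simp
qed

lemma sum_sqrt2_power_le: "(\<Sum>j\<le>J. sqrt 2 ^ j) \<le> 4 * sqrt 2 ^ (J::nat)"
proof (induction J)
  case (Suc J)
  \<comment> \<open>The induction step amounts to
    \<open>4 + sqrt 2 \<le> 4 * sqrt 2\<close>.\<close>
  have "4 / 3 \<le> sqrt (2::real)"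
    by (rule real_le_rsqrt) (simp add: power2_eq_square)
  then have "4 / 3 * sqrt 2 ^ J \<le> sqrt 2 * sqrt 2 ^ J"
    by (rule mult_right_mono) simp
  with Suc show ?case unfolding sum.atMost_Suc power_Suc by linarith
qed simp

section \<open>Dyadic groups of the variance proxies\<close>

locale dyadic_groups =
  fixes n m :: nat and s :: "nat \<Rightarrow> real"
  assumes s_pos: "i < n \<Longrightarrow> 0 < s i" and m: "0 < m" "2 * m < n"
begin

lemma smin: "0 < smin n s" "i < n \<Longrightarrow> smin n s \<le> s i"
proof -
  have "{..<n} \<noteq> {}" using m by auto
  then show "0 < smin n s"
    unfolding smin_def using s_pos by (subst Min_gr_iff) auto
  show "i < n \<Longrightarrow> smin n s \<le> s i"
    unfolding smin_def by (intro Min_le) auto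
qed

text \<open>A common point of two dyadic intervals forces each lower exponent below the other upper
  one. For indices from 1 on the conclusion amounts to \<open>j = k\<close>.\<close>

lemma grp_unique:
  assumes "i \<in> grp n s j" "i \<in> grp n s k"
  shows "j - 1 = k - 1"
proof -
  have less: "a - 1 < b" if "2 ^ (a - 1) \<le> x" "x < (2::real) ^ b" for a b :: nat and x
    using le_less_trans[OF that] by (simp only: power_strict_increasing_iff one_less_numeral_iff semiring_norm)
  have "j - 1 < k" "k - 1 < j"
    using assms less[of j "s i / smin n s" k] less[of k "s i / smin n s" j] by (auto simp: grp_def)
  then show ?thesis by linarith
qed

lemma grp_exists:
  assumes i: "i < n"
  shows "\<exists>j\<ge>1. i \<in> grp n s j"
proof -
  define r where "r = s i / smin n s"
  have r: "1 \<le> r"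
    using smin(1) smin(2)[OF i] by (simp add: r_def)
  obtain k where "r < 2 ^ k"
    using real_arch_pow[of 2 r] by auto
  moreover define j where "j = (LEAST k. r < (2::real) ^ k)"
  ultimately have L: "r < 2 ^ j"
    using LeastI[of "\<lambda>k. r < 2 ^ k"] by simp
  have j: "1 \<le> j"
    using L r by (cases j) auto
  then have "\<not> r < 2 ^ (j - 1)"
    using not_less_Least[of "j - 1" "\<lambda>k. r < 2 ^ k"] by (simp add: j_def[symmetric])
  with L i have "i \<in> grp n s j"
    by (simp add: grp_def r_def[symmetric])
  with j show ?thesis by blast
qed

definition group_index :: "nat \<Rightarrow> nat" where
  "group_index i = (SOME j. 1 \<le> j \<and> i \<in> grp n s j)"

lemma group_index:
  assumes "i < n"
  shows "1 \<le> group_index i" "i \<in> grp n s (group_index i)"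
  using someI_ex[OF grp_exists[OF assms]] by (simp_all add: group_index_def)

lemma grp_eq: "1 \<le> j \<Longrightarrow> grp n s j = {i. i < n \<and> group_index i = j}"
  using group_index grp_unique by (fastforce simp: grp_def)

lemma valid_Gr_card:
  assumes "valid_Gr n m s A" "1 \<le> j"
  shows "card (A \<inter> grp n s j) \<le> 2 * m"
proof -
  have "if card (grp n s j) \<le> 2 * m then A \<inter> grp n s j = grp n s j else card (A \<inter> grp n s j) = 2 * m"
    using assms by (simp add: valid_Gr_def)
  then show ?thesis by (auto split: if_splits)
qed

lemma Gl_subset_valid_Gr: "valid_Gr n m s A \<Longrightarrow> Gl n m s \<subseteq> A"
  unfolding valid_Gr_def Gl_def by fastforce

text \<open>Distinct groups with index from 1 on are disjoint, so the choices inside them are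
  independent and the union meets each group in the chosen part. Hence the maximum in
  \<open>Ent_Gr\<close> is over a nonempty set.\<close>

lemma valid_Gr_exists: "\<exists>A. valid_Gr n m s A"
proof -
  have "\<exists>B. B \<subseteq> grp n s j \<and> (if card (grp n s j) \<le> 2 * m then B = grp n s j else card B = 2 * m)" for j
    using obtain_subset_with_card_n[of "2 * m" "grp n s j"] by (metis nle_le order_refl)
  then obtain B where B: "\<And>j. B j \<subseteq> grp n s j"
    "\<And>j. if card (grp n s j) \<le> 2 * m then B j = grp n s j else card (B j) = 2 * m"
    by metis
  define A where "A = (\<Union>j\<in>{1..}. B j)"
  have "A \<inter> grp n s j = B j" if j: "1 \<le> j" for j
  proof -
    have "i \<in> B j" if "i \<in> B k" "1 \<le> k" "i \<in> grp n s j" for i k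
      using that B(1)[of k] grp_unique[of i j k] j by (cases "j = k") auto
    with B(1)[of j] j show ?thesis by (auto simp: A_def)
  qed
  moreover have "A \<subseteq> {..<n}"
    using B(1) by (auto simp: A_def grp_def)
  ultimately have "valid_Gr n m s A"
    unfolding valid_Gr_def using B(2) by simp
  then show ?thesis ..
qed

lemma Ent_Gr_attained: "\<exists>A. valid_Gr n m s A \<and> Ent_Gr n m s = Ent s A"
proof -
  have "finite {A. valid_Gr n m s A}"
    by (rule finite_subset[of _ "Pow {..<n}"]) (auto simp: valid_Gr_def)
  then have "Ent_Gr n m s \<in> Ent s ` {A. valid_Gr n m s A}"
    unfolding Ent_Gr_def using valid_Gr_exists by (intro Max_in) auto
  then show ?thesis by auto
qed

text \<open>Within a group the proxies agree up to a factor 2, and m arms are fewer than half of a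
  group in the union.\<close>

lemma sum_Gm_le:
  assumes M: "M \<subseteq> {..<n}" "card M = m"
  shows "(\<Sum>i\<in>Gm n m s. s i) \<le> 4 * (\<Sum>i\<in>{..<n} - M. s i)"
proof -
  let ?G = "Gm n m s"
  have G: "?G = {i. i < n \<and> 2 * m < card (grp n s (group_index i))}"
    unfolding Gm_def using grp_eq group_index(1) by auto
  have finG: "finite ?G" unfolding G by simp
  have group: "(\<Sum>i\<in>grp n s j. s i) \<le> 4 * (\<Sum>i\<in>grp n s j - M. s i)"
    if j: "1 \<le> j" and big: "2 * m < card (grp n s j)" for j
  proof -
    let ?b = "smin n s * 2 ^ (j - 1)"
    have b0: "0 < ?b" using smin(1) by simp
    have "(\<Sum>i\<in>grp n s j. s i) \<le> real (card (grp n s j)) * (2 * ?b)"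
    proof (rule sum_bounded_above)
      fix i assume "i \<in> grp n s j"
      then have "s i / smin n s < 2 * 2 ^ (j - 1)"
        using j by (cases j) (auto simp: grp_def)
      then show "s i \<le> 2 * ?b"
        using smin(1) by (simp add: field_simps)
    qed
    \<comment> \<open>Removing \<open>M\<close> takes at most \<open>m\<close> of more than
      \<open>2 * m\<close> arms, which costs a factor 2. The other factor 2 of the 4 is the range of
      proxies within a group.\<close>
    also have "\<dots> \<le> (2 * real (card (grp n s j - M))) * (2 * ?b)"
    proof (rule mult_right_mono)
      have "card (grp n s j) - card M \<le> card (grp n s j - M)"
        by (rule diff_card_le_card_Diff) (use M finite_subset in blast)
      with big M(2) have "card (grp n s j) \<le> 2 * card (grp n s j - M)" by simp
      then show "real (card (grp n s j)) \<le> 2 * real (card (grp n s j - M))" by linarith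
    qed (use b0 in simp)
    finally have "(\<Sum>i\<in>grp n s j. s i) \<le> 4 * (real (card (grp n s j - M)) * ?b)"
      by simp
    also have "real (card (grp n s j - M)) * ?b \<le> (\<Sum>i\<in>grp n s j - M. s i)"
      using smin(1) by (intro sum_bounded_below) (auto simp: grp_def field_simps)
    finally show ?thesis by simp
  qed
  have "(\<Sum>i\<in>?G. s i) = (\<Sum>j\<in>group_index ` ?G. \<Sum>i\<in>{i \<in> ?G. group_index i = j}. s i)"
    by (rule sum.image_gen[OF finG])
  also have "\<dots> \<le> (\<Sum>j\<in>group_index ` ?G. 4 * (\<Sum>i\<in>{i \<in> ?G. group_index i = j} - M. s i))"
  proof (rule sum_mono)
    fix j assume "j \<in> group_index ` ?G"
    then have j: "1 \<le> j" "2 * m < card (grp n s j)"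
      using group_index(1) unfolding G by auto
    have "{i \<in> ?G. group_index i = j} = {i. i < n \<and> group_index i = j}"
      using j(2) unfolding G by blast
    then have "{i \<in> ?G. group_index i = j} = grp n s j"
      by (simp only: grp_eq[OF j(1)])
    with group[OF j] show "(\<Sum>i\<in>{i \<in> ?G. group_index i = j}. s i) \<le> 4 * (\<Sum>i\<in>{i \<in> ?G. group_index i = j} - M. s i)"
      by simp
  qed
  also have "\<dots> = 4 * (\<Sum>j\<in>group_index ` ?G. \<Sum>i\<in>{i \<in> ?G - M. group_index i = j}. s i)"
  proof -
    have "{i \<in> ?G. group_index i = j} - M = {i \<in> ?G - M. group_index i = j}" for j
      by auto
    then show ?thesis
      by (simp only: sum_distrib_left)
  qed
  also have "(\<Sum>j\<in>group_index ` ?G. \<Sum>i\<in>{i \<in> ?G - M. group_index i = j}. s i) = (\<Sum>i\<in>?G - M. s i)"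
    using finG by (intro sum.group) auto
  also have "\<dots> \<le> (\<Sum>i\<in>{..<n} - M. s i)"
    using s_pos unfolding G by (intro sum_mono2) (auto intro: less_imp_le)
  finally show ?thesis by simp
qed

text \<open>Arms above the threshold u contribute at most ln m each; below it, ln x \<le> 2 sqrt x leaves
  a sum of standard deviations that is geometric over the groups.\<close>

lemma weighted_entropy_le:
  assumes A: "A \<subseteq> {..<n}" and cap: "\<And>j. 1 \<le> j \<Longrightarrow> card (A \<inter> grp n s j) \<le> 2 * m"
  shows "weighted_entropy s A \<le> (ln (real m) + 24) * (\<Sum>i\<in>A. s i)"
proof (cases "A = {}")
  case False
  have finA: "finite A" using A finite_subset by blast
  have pos: "0 < s i" if "i \<in> A" for i using that A s_pos by auto
  define Z where "Z = (\<Sum>i\<in>A. s i)"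
  have Z: "0 < Z"
    unfolding Z_def using finA False pos by (intro sum_pos) auto
  \<comment> \<open>With this threshold \<open>Z / s i = m * (u / s i)\<close>, so the logarithm
    splits into \<open>ln m\<close> and a rest that is positive only below \<open>u\<close>.\<close>
  define u where "u = Z / m"
  have u: "0 < u" using Z m by (simp add: u_def)
  define L where "L = {i \<in> A. s i < u}"
  have finL: "finite L" using finA by (simp add: L_def)
  have bound: "s i * ln (Z / s i) \<le> s i * ln m + (if i \<in> L then 2 * (sqrt u * sqrt (s i)) else 0)"
    if i: "i \<in> A" for i
  proof -
    have "ln (Z / s i) = ln m + ln (u / s i)"
      using Z m pos[OF i] by (simp add: u_def ln_div ln_mult)
    moreover have "s i * ln (u / s i) \<le> (if i \<in> L then 2 * (sqrt u * sqrt (s i)) else 0)"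
    proof (cases "i \<in> L")
      case True
      have "ln (u / s i) = 2 * ln (sqrt (u / s i))"
        using u pos[OF i] by (simp add: ln_sqrt)
      also have "\<dots> \<le> 2 * sqrt (u / s i)"
        using ln_le_minus_one[of "sqrt (u / s i)"] u pos[OF i] by simp
      finally have "s i * ln (u / s i) \<le> s i * (2 * sqrt (u / s i))"
        using pos[OF i] by (intro mult_left_mono) auto
      also have "\<dots> = 2 * (sqrt u * sqrt (s i))"
        using pos[OF i] by (simp add: real_sqrt_divide field_simps)
      finally show ?thesis using True by simp
    next
      case False
      then have "ln (u / s i) \<le> 0"
        using i u pos[OF i] by (auto simp: L_def)
      with False pos[OF i] show ?thesis
        by (simp add: mult_nonneg_nonpos)
    qed
    ultimately show ?thesis by (simp add: algebra_simps)
  qed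
  \<comment> \<open>The highest group that meets \<open>L\<close> contains an arm below
    \<open>u\<close>, so its lower endpoint is below \<open>u\<close>. With at most
    \<open>2 * m\<close> arms per group, the geometric sum is controlled by that endpoint.\<close>
  have sq: "(\<Sum>i\<in>L. sqrt (s i)) \<le> 12 * m * sqrt u"
  proof (cases "L = {}")
    case False
    define J where "J = Max (group_index ` L)"
    have "J \<in> group_index ` L"
      unfolding J_def using finL False by (intro Max_in) auto
    then obtain i0 where i0: "i0 \<in> L" "J = group_index i0" by auto
    have Ln: "i < n" if "i \<in> L" for i using that A by (auto simp: L_def)
    let ?b = "sqrt (smin n s)"
    have b0: "0 < ?b" using smin(1) by simp
    have J1: "1 \<le> J"
      using i0 group_index(1) Ln by auto
    have top: "?b * sqrt 2 ^ (J - 1) \<le> sqrt u"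
    proof -
      have "2 ^ (J - 1) \<le> s i0 / smin n s"
        using group_index(2)[OF Ln[OF i0(1)]] i0(2) by (auto simp: grp_def)
      then have "smin n s * 2 ^ (J - 1) \<le> u"
        using i0(1) smin(1) by (simp add: L_def field_simps)
      then have "sqrt (smin n s * 2 ^ (J - 1)) \<le> sqrt u" by simp
      then show ?thesis by (simp add: real_sqrt_mult real_sqrt_power)
    qed
    have "(\<Sum>i\<in>L. sqrt (s i)) = (\<Sum>j\<in>group_index ` L. \<Sum>i\<in>{i \<in> L. group_index i = j}. sqrt (s i))"
      by (rule sum.image_gen[OF finL])
    also have "\<dots> \<le> (\<Sum>j\<in>group_index ` L. 2 * m * (?b * sqrt 2 ^ j))"
    proof (rule sum_mono)
      fix j assume "j \<in> group_index ` L"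
      then have j: "1 \<le> j" using group_index(1) Ln by auto
      have "(\<Sum>i\<in>{i \<in> L. group_index i = j}. sqrt (s i)) \<le> real (card {i \<in> L. group_index i = j}) * (?b * sqrt 2 ^ j)"
      proof (rule sum_bounded_above)
        fix i assume i: "i \<in> {i \<in> L. group_index i = j}"
        then have "s i / smin n s < 2 ^ j"
          using group_index(2)[of i] Ln by (auto simp: grp_def)
        then have "s i \<le> smin n s * 2 ^ j"
          using smin(1) by (simp add: field_simps)
        then have "sqrt (s i) \<le> sqrt (smin n s * 2 ^ j)" by simp
        then show "sqrt (s i) \<le> ?b * sqrt 2 ^ j"
          by (simp add: real_sqrt_mult real_sqrt_power)
      qed
      also have "card {i \<in> L. group_index i = j} \<le> card (A \<inter> grp n s j)"
        using finA grp_eq[OF j] Ln by (intro card_mono) (auto simp: L_def)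
      also have "card (A \<inter> grp n s j) \<le> 2 * m"
        by (rule cap[OF j])
      finally show "(\<Sum>i\<in>{i \<in> L. group_index i = j}. sqrt (s i)) \<le> 2 * m * (?b * sqrt 2 ^ j)"
        using b0 by (simp add: mult_right_mono)
    qed
    also have "\<dots> \<le> (\<Sum>j\<le>J. 2 * m * (?b * sqrt 2 ^ j))"
      using finL b0 by (intro sum_mono2) (auto simp: J_def)
    also have "\<dots> = 2 * m * ?b * (\<Sum>j\<le>J. sqrt 2 ^ j)"
      by (simp add: sum_distrib_left mult_ac)
    also have "\<dots> \<le> 2 * m * ?b * (4 * sqrt 2 ^ J)"
      using b0 by (intro mult_left_mono sum_sqrt2_power_le) auto
    also have "\<dots> = 8 * m * sqrt 2 * (?b * sqrt 2 ^ (J - 1))"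
      using J1 by (cases J) auto
    \<comment> \<open>The 8 is 2 from the group size times 4 from the geometric sum; rounding
      \<open>sqrt 2\<close> up to 3/2 makes it 12.\<close>
    also have "\<dots> \<le> 8 * m * (3/2) * sqrt u"
    proof (intro mult_mono top)
      show "sqrt 2 \<le> 3/2"
        by (rule real_le_lsqrt) (auto simp: power2_eq_square)
    qed (use b0 in auto)
    finally show ?thesis by simp
  qed (use u in simp)
  have "weighted_entropy s A \<le> (\<Sum>i\<in>A. s i * ln m + (if i \<in> L then 2 * (sqrt u * sqrt (s i)) else 0))"
    unfolding weighted_entropy_def Z_def[symmetric] by (intro sum_mono bound)
  also have "\<dots> = Z * ln m + 2 * sqrt u * (\<Sum>i\<in>L. sqrt (s i))"
  proof -
    have "(\<Sum>i\<in>A. if i \<in> L then 2 * (sqrt u * sqrt (s i)) else 0) = (\<Sum>i\<in>L. 2 * (sqrt u * sqrt (s i)))"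
      using finA by (subst sum.inter_restrict[symmetric]) (auto simp: L_def intro!: sum.cong)
    then show ?thesis
      by (simp add: sum.distrib Z_def sum_distrib_right sum_distrib_left mult.assoc)
  qed
  also have "\<dots> \<le> Z * ln m + 2 * sqrt u * (12 * m * sqrt u)"
    using sq u by (intro add_left_mono mult_left_mono) auto
  also have "\<dots> = Z * ln m + 24 * (m * (sqrt u * sqrt u))" by simp
  also have "\<dots> = (ln m + 24) * Z"
    using Z m by (simp add: u_def algebra_simps)
  finally show ?thesis by (simp add: Z_def)
qed (simp add: weighted_entropy_def)

text \<open>The maximising set \<open>A\<close> contains \<open>Gl\<close>, and
  \<open>Ent s A\<close> is nonnegative, so the left side is at most the weighted entropy of
  \<open>A\<close>. Splitting \<open>A\<close> along \<open>H\<close> leaves a part controlled by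
  monotonicity and a part outside \<open>M\<close> controlled by the group sizes. The 25 is 24 for
  that part and 1 for the \<open>ln 2\<close> of the split.\<close>

lemma Gl_Ent_Gr_le:
  assumes H: "H \<subseteq> {..<n}" "M \<subseteq> H"
  shows "(\<Sum>i\<in>Gl n m s. s i) * Ent_Gr n m s \<le>
    weighted_entropy s H + ln (real m) * (\<Sum>i\<in>{..<n} - M. s i) + 25 * (\<Sum>i<n. s i)"
proof -
  obtain A where A: "valid_Gr n m s A" "Ent_Gr n m s = Ent s A"
    using Ent_Gr_attained by blast
  have An: "A \<subseteq> {..<n}" using A(1) by (simp add: valid_Gr_def)
  have fin: "finite A" "finite H" using An H finite_subset by blast+
  have posA: "0 < s i" if "i \<in> A" for i using that An s_pos by auto
  have posH: "0 < s i" if "i \<in> H" for i using that H s_pos by auto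
  have sub: "(\<Sum>i\<in>B. s i) \<le> (\<Sum>i\<in>C. s i)" if "B \<subseteq> C" "C \<subseteq> {..<n}" for B C
    using that s_pos finite_subset[OF that(2)] by (intro sum_mono2) (auto intro: less_imp_le)
  have lnm: "0 \<le> ln (real m)" using m by simp
  have "(\<Sum>i\<in>Gl n m s. s i) * Ent_Gr n m s \<le> weighted_entropy s A"
  proof (cases "A = {}")
    case True
    then show ?thesis
      using Gl_subset_valid_Gr[OF A(1)] by (simp add: weighted_entropy_def)
  next
    case False
    have ZE: "(\<Sum>i\<in>A. s i) * Ent s A = weighted_entropy s A"
      using fin(1) False posA by (intro Ent_eq_weighted_entropy)
    have "0 < (\<Sum>i\<in>A. s i)"
      using fin(1) False posA by (intro sum_pos)
    moreover have "0 \<le> (\<Sum>i\<in>A. s i) * Ent s A"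
      unfolding ZE using fin(1) posA by (intro weighted_entropy_nonneg)
    ultimately have "0 \<le> Ent s A"
      by (simp add: zero_le_mult_iff)
    moreover have "(\<Sum>i\<in>Gl n m s. s i) \<le> (\<Sum>i\<in>A. s i)"
      by (intro sub Gl_subset_valid_Gr A An)
    ultimately show ?thesis
      unfolding A(2) ZE[symmetric] by (intro mult_right_mono)
  qed
  also have "\<dots> = weighted_entropy s ((A \<inter> H) \<union> (A - H))"
    by (simp add: Int_Diff_Un)
  also have "\<dots> \<le> weighted_entropy s (A \<inter> H) + weighted_entropy s (A - H)
    + ln 2 * (\<Sum>i\<in>(A \<inter> H) \<union> (A - H). s i)"
    using fin posA by (intro weighted_entropy_Un_le) auto
  also have "weighted_entropy s (A \<inter> H) \<le> weighted_entropy s H"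
    using fin posH by (intro weighted_entropy_mono) auto
  also have "weighted_entropy s (A - H) \<le> (ln (real m) + 24) * (\<Sum>i\<in>A - H. s i)"
  proof (rule weighted_entropy_le)
    fix j :: nat assume "1 \<le> j"
    then have "card (A \<inter> grp n s j) \<le> 2 * m"
      by (rule valid_Gr_card[OF A(1)])
    moreover have "card ((A - H) \<inter> grp n s j) \<le> card (A \<inter> grp n s j)"
      using fin by (intro card_mono) auto
    ultimately show "card ((A - H) \<inter> grp n s j) \<le> 2 * m" by simp
  qed (use An in auto)
  also have "(ln (real m) + 24) * (\<Sum>i\<in>A - H. s i) \<le>
    ln (real m) * (\<Sum>i\<in>{..<n} - M. s i) + 24 * (\<Sum>i<n. s i)"
  proof -
    have "ln (real m) * (\<Sum>i\<in>A - H. s i) \<le> ln (real m) * (\<Sum>i\<in>{..<n} - M. s i)"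
      using An H by (intro mult_left_mono sub lnm) auto
    moreover have "(\<Sum>i\<in>A - H. s i) \<le> (\<Sum>i<n. s i)"
      using An by (intro sub) auto
    ultimately show ?thesis by (simp add: distrib_right)
  qed
  also have "ln 2 * (\<Sum>i\<in>(A \<inter> H) \<union> (A - H). s i) \<le> 1 * (\<Sum>i<n. s i)"
  proof (intro mult_mono sub)
    show "ln (2::real) \<le> 1" using ln_le_minus_one[of "2::real"] by simp
    show "0 \<le> (\<Sum>i\<in>(A \<inter> H) \<union> (A - H). s i)"
      using posA by (intro sum_nonneg) (auto intro: less_imp_le)
  qed (use An in auto)
  finally show ?thesis by (simp add: algebra_simps)
qed

end

section \<open>Combination of the three lower bounds\<close>

context top_m_solver
begin

sublocale dyadic_groups n m s
  by unfold_locales (use s_pos m in auto)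

text \<open>Product weights are used on all arms, uniform weights on the \<open>m\<close> most
  variable arms \<open>M\<close> together with \<open>m + 1\<close> arbitrary others. A linear
  combination of the three bounds dominates the claimed quantity, so one of the bounds is a constant
  fraction of it.\<close>

lemma instance_lower_bound:
  "\<exists>\<mu>. ennreal (1 / 10000 * ((\<Sum>i<n. s i / \<epsilon>\<^sup>2) * ln (1 / \<delta>)
      + (\<Sum>i\<in>Gm n m s. s i / \<epsilon>\<^sup>2) * ln (real m)
      + (\<Sum>j\<in>Gl n m s. s j / \<epsilon>\<^sup>2) * Ent_Gr n m s))
    \<le> expected_samples n R (gauss_inst n s \<mu>) alg"
proof -
  let ?E = "\<lambda>\<mu>. expected_samples n R (gauss_inst n s \<mu>) alg"
  let ?F = "subsets_of_card {..<n} m"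
  have nn: "0 \<le> s i" if "i < n" for i using s_pos[OF that] by simp
  have "{..<m} \<in> ?F" using m by (auto simp: subsets_of_card_def)
  then have "Max (sum s ` ?F) \<in> sum s ` ?F"
    by (intro Max_in finite_imageI finite_subsets_of_card) auto
  then obtain M where M: "M \<subseteq> {..<n}" "card M = m" and Mmax: "sum s M = Max (sum s ` ?F)"
    by (auto simp: subsets_of_card_def)
  have finM: "finite M" using M finite_subset by blast
  have "m + 1 \<le> card ({..<n} - M)"
    using M m finM by (simp add: card_Diff_subset)
  then obtain K where K: "K \<subseteq> {..<n} - M" "card K = m + 1"
    by (meson obtain_subset_with_card_n)
  define H where "H = M \<union> K"
  have "finite K" using K finite_subset by blast
  then have "card H = card M + card K"
    unfolding H_def using K finM by (intro card_Un_disjoint) auto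
  with M K have H: "H \<subseteq> {..<n}" "M \<subseteq> H" "card H = 2 * m + 1"
    by (auto simp: H_def)
  define Z where "Z = (\<Sum>i<n. s i)"
  define \<tau> where "\<tau> = (\<Sum>i\<in>{..<n} - M. s i)"
  define h where "h = weighted_entropy s H"
  define ZH where "ZH = (\<Sum>i\<in>H. s i)"
  have ZH: "0 \<le> ZH" "ZH \<le> Z"
    unfolding ZH_def Z_def using H nn by (auto intro!: sum_nonneg sum_mono2)
  have \<tau>0: "0 \<le> \<tau>"
    unfolding \<tau>_def using nn by (intro sum_nonneg) auto
  \<comment> \<open>Removing the \<open>m\<close> most variable arms leaves the least variance among
    all removals of \<open>m\<close> arms.\<close>
  have \<tau>_le: "\<tau> \<le> (\<Sum>a\<in>{..<n} - S. s a)" if S: "S \<in> ?F" for S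
  proof -
    have "sum s S \<le> sum s M"
      unfolding Mmax using S by (intro Max_ge finite_imageI finite_subsets_of_card) auto
    moreover have "S \<subseteq> {..<n}" using S by (simp add: subsets_of_card_def)
    ultimately show ?thesis
      using M by (simp add: \<tau>_def sum_diff)
  qed
  define Q where "Q = Z * ln (1 / \<delta>) + (\<Sum>i\<in>Gm n m s. s i) * ln (real m)
    + (\<Sum>j\<in>Gl n m s. s j) * Ent_Gr n m s"
  define y1 where "y1 = Z * ln (16 / 25 / \<delta>) / 360"
  define y2 where "y2 = (ln (real m + 1) * \<tau> + ln (16/25) * Z) / 160"
  define y3 where "y3 = ((h - ln 2 * ZH) / 4 + ln (16/25) * ZH) / 160"
  have b1: "\<exists>\<mu>. ennreal (y1 / \<epsilon>\<^sup>2) \<le> ?E \<mu>"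
  proof -
    have "y1 / \<epsilon>\<^sup>2 = (\<Sum>a<n. s a / (360 * \<epsilon>\<^sup>2) * ln (16 / 25 / \<delta>))"
      unfolding y1_def Z_def sum_distrib_right sum_divide_distrib by (intro sum.cong refl) simp
    then show ?thesis
      using confidence_lower_bound by auto
  qed
  have b2: "\<exists>\<mu>. ennreal (y2 / \<epsilon>\<^sup>2) \<le> ?E \<mu>"
    using product_weights_lower_bound[OF \<tau>_le] by (auto simp: y2_def Z_def)
  have b3: "\<exists>\<mu>. ennreal (y3 / \<epsilon>\<^sup>2) \<le> ?E \<mu>"
    using uniform_weights_lower_bound[OF H(1,3)] by (auto simp: y3_def h_def ZH_def)
  have disj: "1 / 10000 * Q \<le> y1 \<or> 1 / 10000 * Q \<le> y2 \<or> 1 / 10000 * Q \<le> y3"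
  proof -
    have l64: "- (9/16) \<le> ln (16/25::real)"
      using ln_le_minus_one[of "25/16::real"] ln_inverse[of "25/16::real"] by simp
    have l2: "ln (2::real) \<le> 1"
      using ln_le_minus_one[of "2::real"] by simp
    \<comment> \<open>Together with \<open>\<delta> < 1/10\<close> this gives
      \<open>ln (1 / \<delta>) \<ge> 2\<close>, so all error terms that are multiples of
      \<open>Z\<close> are absorbed by the confidence term.\<close>
    have "exp (2::real) \<le> 10"
    proof -
      have "exp (2::real) = exp 1 * exp 1" by (simp add: mult_exp_exp)
      also have "\<dots> \<le> 3 * 3" using exp_le by (intro mult_mono) auto
      finally show ?thesis by simp
    qed
    also have "10 \<le> 1 / \<delta>" using \<delta> by (simp add: field_simps)
    finally have "2 \<le> ln (1 / \<delta>)" using \<delta> by (subst ln_ge_iff) auto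
    then have 1: "Z * 2 \<le> Z * ln (1 / \<delta>)"
      using ZH by (intro mult_left_mono) auto
    have "ln (16 / 25 / \<delta>) = ln (16/25) + ln (1 / \<delta>)"
      using \<delta> by (subst ln_mult_pos[symmetric]) auto
    then have y1: "360 * y1 = Z * ln (16/25) + Z * ln (1 / \<delta>)"
      by (simp add: y1_def distrib_left)
    have 2: "Z * - (9/16) \<le> Z * ln (16/25)" "ZH * - (9/16) \<le> ZH * ln (16/25)"
      using ZH l64 by (intro mult_left_mono; simp)+
    have y2: "160 * y2 = ln (real m + 1) * \<tau> + Z * ln (16/25)"
      by (simp add: y2_def mult.commute)
    have y3: "640 * y3 = h - ZH * ln 2 + 4 * (ZH * ln (16/25))"
      by (simp add: y3_def mult.commute)
    have 3: "ZH * ln 2 \<le> ZH * 1"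
      using ZH l2 by (intro mult_left_mono) auto
    have 4: "ln (real m) * \<tau> \<le> ln (real m + 1) * \<tau>"
      using m \<tau>0 by (intro mult_right_mono ln_mono) auto
    have 5: "(\<Sum>i\<in>Gm n m s. s i) * ln (real m) \<le> 4 * (ln (real m) * \<tau>)"
      using mult_right_mono[OF sum_Gm_le[OF M], of "ln (real m)"] m by (simp add: \<tau>_def mult_ac)
    have 6: "(\<Sum>i\<in>Gl n m s. s i) * Ent_Gr n m s \<le> h + ln (real m) * \<tau> + 25 * Z"
      unfolding h_def \<tau>_def Z_def by (rule Gl_Ent_Gr_le[OF H(1,2)])
    define x1 where "x1 = Z * ln (1 / \<delta>)"
    define x2 where "x2 = ln (real m + 1) * \<tau>"
    define x3 where "x3 = ln (real m) * \<tau>"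
    have "Q \<le> x1 + 5 * x3 + h + 25 * Z"
      using 5 6 unfolding Q_def x1_def[symmetric] x3_def[symmetric] by linarith
    moreover have "x1 \<le> 360 * y1 + 9/16 * Z"
      using y1 2(1) unfolding x1_def by linarith
    moreover have "x2 \<le> 160 * y2 + 9/16 * Z"
      using y2 2(1) unfolding x2_def by linarith
    moreover have "h \<le> 640 * y3 + 13/4 * Z"
      using y3 3 2(2) ZH by linarith
    moreover have "x3 \<le> x2" "2 * Z \<le> x1"
      using 4 1 by (simp_all add: x1_def x2_def x3_def)
    moreover have y1_nonneg: "0 \<le> y1"
      using y1 1 2(1) ZH by linarith
    \<comment> \<open>The coefficients 800 and 640 are 5 times 160 and the denominator of
      \<open>y3\<close>. The terms in \<open>Z\<close> add up to less than
      \<open>32 * Z \<le> 16 * x1\<close>, and \<open>x1\<close> is at most 360 * 32/23 times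
      \<open>y1\<close>, which leads to 8500.\<close>
    ultimately have Q: "Q \<le> 8500 * y1 + 800 * y2 + 640 * y3"
      by linarith
    \<comment> \<open>The coefficients sum to 9940, below 10000. If all three bounds failed,
      \<open>Q\<close> would be positive because \<open>y1\<close> is nonnegative, and the
      inequality \<open>Q\<close> would be violated.\<close>
    show ?thesis
    proof (rule ccontr)
      assume "\<not> ?thesis"
      then have "y1 < 1 / 10000 * Q" "y2 < 1 / 10000 * Q" "y3 < 1 / 10000 * Q"
        by simp_all
      with Q y1_nonneg show False
        by linarith
    qed
  qed
  have "\<exists>\<mu>. ennreal (1 / 10000 * Q / \<epsilon>\<^sup>2) \<le> ?E \<mu>"
  proof -
    have scale: "\<exists>\<mu>. ennreal (1 / 10000 * Q / \<epsilon>\<^sup>2) \<le> ?E \<mu>"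
      if le: "1 / 10000 * Q \<le> y" and y: "\<exists>\<mu>. ennreal (y / \<epsilon>\<^sup>2) \<le> ?E \<mu>" for y
    proof -
      have "ennreal (1 / 10000 * Q / \<epsilon>\<^sup>2) \<le> ennreal (y / \<epsilon>\<^sup>2)"
        by (intro ennreal_leI divide_right_mono le) simp
      moreover obtain \<mu> where "ennreal (y / \<epsilon>\<^sup>2) \<le> ?E \<mu>"
        using y ..
      ultimately show ?thesis
        by (intro exI[of _ \<mu>]) (rule order_trans)
    qed
    show ?thesis
      using disj by (elim disjE) (fact scale[OF _ b1] scale[OF _ b2] scale[OF _ b3])+
  qed
  moreover have "1 / 10000 * Q / \<epsilon>\<^sup>2 = 1 / 10000 * ((\<Sum>i<n. s i / \<epsilon>\<^sup>2) * ln (1 / \<delta>)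
      + (\<Sum>i\<in>Gm n m s. s i / \<epsilon>\<^sup>2) * ln (real m)
      + (\<Sum>j\<in>Gl n m s. s j / \<epsilon>\<^sup>2) * Ent_Gr n m s)"
  proof -
    have "1 / 10000 * (a * l + b * k + c * e) / d = 1 / 10000 * (a / d * l + b / d * k + c / d * e)"
      for a b c d e k l :: real
      by (simp add: add_divide_distrib)
    then show ?thesis
      unfolding Q_def Z_def sum_divide_distrib[symmetric] .
  qed
  ultimately show ?thesis by (simp only:)
qed

end

theorem theorem3:
  shows "\<exists>c>0. \<forall>(\<epsilon>::real) (\<delta>::real) (n::nat) (m::nat) (s::nat \<Rightarrow> real)
            (R::real measure) (alg::real \<Rightarrow> (nat \<times> real) list \<Rightarrow> action).
    \<epsilon> > 0 \<longrightarrow> 0 < \<delta> \<longrightarrow> \<delta> < 1/10 \<longrightarrow> 0 < m \<longrightarrow> real m < real n / 2 \<longrightarrow>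
    (\<forall>i<n. s i > 0) \<longrightarrow>
    prob_space R \<longrightarrow> sets R = sets borel \<longrightarrow> alg_measurable n alg \<longrightarrow>
    solves n m s \<epsilon> \<delta> R alg \<longrightarrow>
    (\<exists>\<nu>. bandit_instance n s \<nu> \<and>
       expected_samples n R \<nu> alg \<ge>
         ennreal (c * ((\<Sum>i<n. s i / \<epsilon>\<^sup>2) * ln (1 / \<delta>)
                     + (\<Sum>i\<in>Gm n m s. s i / \<epsilon>\<^sup>2) * ln (real m)
                     + (\<Sum>j\<in>Gl n m s. s j / \<epsilon>\<^sup>2) * Ent_Gr n m s)))"
proof (rule exI[of _ "1 / 10000"], rule conjI, simp, intro allI impI)
  fix \<epsilon> \<delta> :: real and n m :: nat and s :: "nat \<Rightarrow> real"
    and R :: "real measure" and alg :: "real \<Rightarrow> (nat \<times> real) list \<Rightarrow> action"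
  assume asm: "\<epsilon> > 0" "0 < \<delta>" "\<delta> < 1/10" "0 < m" "real m < real n / 2" "\<forall>i<n. s i > 0"
    "prob_space R" "sets R = sets borel" "alg_measurable n alg" "solves n m s \<epsilon> \<delta> R alg"
  have mn: "2 * m < n"
    using asm(5) by linarith
  interpret top_m_solver n s R alg m \<epsilon> \<delta>
  proof (intro top_m_solver.intro bandit.intro top_m_solver_axioms.intro)
    show "0 < s i" if "i < n" for i
      using asm(6) that by simp
  qed (fact asm mn)+
  obtain \<mu> where "ennreal (1 / 10000 * ((\<Sum>i<n. s i / \<epsilon>\<^sup>2) * ln (1 / \<delta>)
      + (\<Sum>i\<in>Gm n m s. s i / \<epsilon>\<^sup>2) * ln (real m)
      + (\<Sum>j\<in>Gl n m s. s j / \<epsilon>\<^sup>2) * Ent_Gr n m s))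
    \<le> expected_samples n R (gauss_inst n s \<mu>) alg"
    using instance_lower_bound by blast
  then show "\<exists>\<nu>. bandit_instance n s \<nu> \<and>
       expected_samples n R \<nu> alg \<ge>
         ennreal (1 / 10000 * ((\<Sum>i<n. s i / \<epsilon>\<^sup>2) * ln (1 / \<delta>)
                     + (\<Sum>i\<in>Gm n m s. s i / \<epsilon>\<^sup>2) * ln (real m)
                     + (\<Sum>j\<in>Gl n m s. s j / \<epsilon>\<^sup>2) * Ent_Gr n m s))"
    using bandit_instance_gauss_inst[of n s \<mu>] s_pos by blast
qed

end
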